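(* Let $K=\langle a,b,t,u \mid t^2=u^2=(tu)^4=1,\ ab=ba,\ a^t=b,\ a^u=a,\ b^u=b\rangle\cong\mathbb{Z}^2\rtimes D_8$, where the generators $Z'=\{a^{\pm1},b^{\pm1},t,u\}$ are totally ordered with $a^{\pm1}<b^{\pm1}<t<u$. Then $\mathsf{Geo}(K,Z')$, $\mathsf{SL}(K,Z')$, $\mathsf{ConjGeo}(K,Z')$ and $\mathsf{ConjMinLenSL}(K,Z')$ are regular languages, but $\mathsf{ConjSL}(K,Z')$ is not regular.
   Context: Here $g^h=h^{-1}gh$, $D_8$ is the dihedral group of order 8, and $a^{\pm1}<b^{\pm1}<t<u$ means that both of $a,a^{-1}$ precede both of $b,b^{-1}$, which precede $t$, which precedes $u$. For $w\in Z'^*$, $l(w)$ is its length and $\pi(w)$ the element of $K$ it represents. For $g\in K$, $|g|$ is the length of a shortest word over $Z'$ representing $g$, and $|g|_c=\min\{|h| : h\text{ conjugate to }g\text{ in }K\}$. $\mathsf{Geo}(K,Z')=\{w : l(w)=|\pi(w)|\}$ and $\mathsf{ConjGeo}(K,Z')=\{w : l(w)=|\pi(w)|_c\}$. The shortlex ordering on $Z'^*$ compares words first by length and then, for equal length, lexicographically; $y_g$ denotes the shortlex least word representing $g\in K$, and $z_\kappa$ the shortlex least word representing an element of the conjugacy class $\kappa$. $\mathsf{SL}(K,Z')=\{y_g : g\in K\}$, $\mathsf{ConjMinLenSL}(K,Z')=\{y_g : g\in K,\ |g|=|g|_c\}$ and $\mathsf{ConjSL}(K,Z')=\{z_\kappa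 : \kappa\text{ a conjugacy class of }K\}$. A language is regular if it is accepted by a finite state automaton. *)

theory Defs
  imports "HOL-Algebra.Elementary_Groups"
begin

section \<open>Groups given by presentations\<close>

text \<open>Words in the generators and their inverses: \<open>(x, True)\<close> stands for the generator \<open>x\<close> and
  \<open>(x, False)\<close> for its formal inverse. A relation \<open>v = w\<close> of the presentation is the pair
  \<open>(v, w)\<close>; the presented group is the quotient of the free monoid on these letters by
  the congruence generated by free cancellation and the relations. Every element of the type of
  generators is a generator.\<close>

type_synonym 'x gword = "('x \<times> bool) list"

abbreviation gen :: "'x \<Rightarrow> 'x gword" where "gen x \<equiv> [(x, True)]"
abbreviation gen_inv :: "'x \<Rightarrow> 'x gword" where "gen_inv x \<equiv> [(x, False)]"

inductive pres_eq :: "('x gword \<times> 'x gword) set \<Rightarrow> 'x gword \<Rightarrow> 'x gword \<Rightarrow> bool"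
  for R where
  refl: "pres_eq R w w"
| sym: "pres_eq R v w \<Longrightarrow> pres_eq R w v"
| trans: "pres_eq R u v \<Longrightarrow> pres_eq R v w \<Longrightarrow> pres_eq R u w"
| append: "pres_eq R v v' \<Longrightarrow> pres_eq R w w' \<Longrightarrow> pres_eq R (v @ w) (v' @ w')"
| cancel: "pres_eq R [(x, e), (x, \<not> e)] []"
| rel: "(v, w) \<in> R \<Longrightarrow> pres_eq R v w"

definition pres_class :: "('x gword \<times> 'x gword) set \<Rightarrow> 'x gword \<Rightarrow> 'x gword set" where
  "pres_class R w = {v. pres_eq R w v}"

definition presented_group :: "('x gword \<times> 'x gword) set \<Rightarrow> 'x gword set monoid" where
  "presented_group R =
     \<lparr>carrier = range (pres_class R),
      mult = (\<lambda>X Y. \<Union>x\<in>X. \<Union>y\<in>Y. pres_class R (x @ y)),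
      one = pres_class R []\<rparr>"

lemma pres_class_eq_iff: "pres_class R v = pres_class R w \<longleftrightarrow> pres_eq R v w"
  unfolding pres_class_def by (auto intro: pres_eq.refl pres_eq.sym pres_eq.trans)

lemma presented_group_mult [simp]:
  "pres_class R v \<otimes>\<^bsub>presented_group R\<^esub> pres_class R w = pres_class R (v @ w)"
proof -
  have *: "pres_class R (x @ y) = pres_class R (v @ w)"
    if "x \<in> pres_class R v" "y \<in> pres_class R w" for x y
    using that unfolding pres_class_eq_iff
    by (auto simp: pres_class_def intro: pres_eq.append pres_eq.sym)
  have "v \<in> pres_class R v" "w \<in> pres_class R w"
    by (auto simp: pres_class_def intro: pres_eq.refl)
  then have "(\<Union>x\<in>pres_class R v. \<Union>y\<in>pres_class R w. pres_class R (x @ y))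
      = pres_class R (v @ w)"
    using * by blast
  then show ?thesis by (simp add: presented_group_def)
qed

lemma pres_eq_left_inverse: "\<exists>v. pres_eq R (v @ w) []"
proof (induction w)
  case Nil
  show ?case by (auto intro: exI[of _ "[]"] pres_eq.refl)
next
  case (Cons l w)
  obtain x e where l: "l = (x, e)" by force
  from Cons obtain v where v: "pres_eq R (v @ w) []" by blast
  have "pres_eq R [(x, \<not> e), (x, e)] []"
    using pres_eq.cancel[of R x "\<not> e"] by simp
  then have "pres_eq R (v @ ([(x, \<not> e), (x, e)] @ w)) (v @ ([] @ w))"
    by (intro pres_eq.append pres_eq.refl)
  then have "pres_eq R ((v @ [(x, \<not> e)]) @ (l # w)) []"
    using pres_eq.trans[OF _ v] l by simp
  then show ?case by blast
qed

lemma presented_group_is_group: "group (presented_group R)"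
proof (rule groupI)
  have c: "carrier (presented_group R) = range (pres_class R)"
    and o: "\<one>\<^bsub>presented_group R\<^esub> = pres_class R []"
    by (auto simp: presented_group_def)
  show "\<one>\<^bsub>presented_group R\<^esub> \<in> carrier (presented_group R)" by (simp add: c o)
  fix X assume "X \<in> carrier (presented_group R)"
  then obtain x where X: "X = pres_class R x" by (auto simp: c)
  show "\<one>\<^bsub>presented_group R\<^esub> \<otimes>\<^bsub>presented_group R\<^esub> X = X" by (simp add: X o)
  obtain v where "pres_eq R (v @ x) []" using pres_eq_left_inverse by blast
  then have "pres_class R v \<otimes>\<^bsub>presented_group R\<^esub> X = \<one>\<^bsub>presented_group R\<^esub>"
    by (simp add: X o pres_class_eq_iff)
  then show "\<exists>Y\<in>carrier (presented_group R). Y \<otimes>\<^bsub>presented_group R\<^esub> X = \<one>\<^bsub>presented_group R\<^esub>"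
    by (auto simp: c)
  fix Y assume "Y \<in> carrier (presented_group R)"
  then obtain y where Y: "Y = pres_class R y" by (auto simp: c)
  show "X \<otimes>\<^bsub>presented_group R\<^esub> Y \<in> carrier (presented_group R)" by (simp add: X Y c)
  fix Z assume "Z \<in> carrier (presented_group R)"
  then obtain z where Z: "Z = pres_class R z" by (auto simp: c)
  show "X \<otimes>\<^bsub>presented_group R\<^esub> Y \<otimes>\<^bsub>presented_group R\<^esub> Z
      = X \<otimes>\<^bsub>presented_group R\<^esub> (Y \<otimes>\<^bsub>presented_group R\<^esub> Z)"
    by (simp add: X Y Z)
qed


section \<open>Semidirect products and dihedral groups\<close>

definition semidirect_product ::
  "('n, 'p) monoid_scheme \<Rightarrow> ('h, 'q) monoid_scheme \<Rightarrow> ('h \<Rightarrow> 'n \<Rightarrow> 'n) \<Rightarrow> ('n \<times> 'h) monoid" where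
  "semidirect_product N H \<phi> =
     \<lparr>carrier = carrier N \<times> carrier H,
      mult = (\<lambda>(m, g) (n, h). (m \<otimes>\<^bsub>N\<^esub> \<phi> g n, g \<otimes>\<^bsub>H\<^esub> h)),
      one = (\<one>\<^bsub>N\<^esub>, \<one>\<^bsub>H\<^esub>)\<rparr>"

text \<open>The dihedral group of order \<open>2 * n\<close>: the pair \<open>(i, e)\<close> stands for the \<open>i\<close>-th power of the
  rotation, followed by a fixed reflection \<open>s\<close> if \<open>e\<close> holds, so \<open>s\<close> inverts the rotation.\<close>

definition dihedral_group :: "nat \<Rightarrow> (int \<times> bool) monoid" where
  "dihedral_group n =
     \<lparr>carrier = {0..<int n} \<times> UNIV,
      mult = (\<lambda>(i, e) (j, f). ((if e then i - j else i + j) mod int n, e \<noteq> f)),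
      one = (0, False)\<rparr>"

lemma order_dihedral_group: "order (dihedral_group n) = 2 * n"
  by (simp add: dihedral_group_def order_def card_cartesian_product)

lemma dihedral_group_is_group:
  assumes "n > 0" shows "group (dihedral_group n)"
proof (rule groupI)
  let ?D = "dihedral_group n"
  show "\<one>\<^bsub>?D\<^esub> \<in> carrier ?D" using assms by (simp add: dihedral_group_def)
  fix x assume x: "x \<in> carrier ?D"
  obtain i e where ie: "x = (i, e)" by force
  have i: "0 \<le> i" "i < int n" using x ie by (auto simp: dihedral_group_def)
  show "\<one>\<^bsub>?D\<^esub> \<otimes>\<^bsub>?D\<^esub> x = x" using i by (simp add: dihedral_group_def ie)
  show "\<exists>y\<in>carrier ?D. y \<otimes>\<^bsub>?D\<^esub> x = \<one>\<^bsub>?D\<^esub>"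
  proof (cases e)
    case True
    with x show ?thesis
      by (intro bexI[of _ x]) (simp_all add: dihedral_group_def ie)
  next
    case False
    with assms show ?thesis
      by (intro bexI[of _ "((- i) mod int n, False)"])
        (simp_all add: dihedral_group_def ie mod_add_left_eq)
  qed
  fix y assume "y \<in> carrier ?D"
  obtain j f where jf: "y = (j, f)" by force
  show "x \<otimes>\<^bsub>?D\<^esub> y \<in> carrier ?D" using assms by (simp add: dihedral_group_def ie jf)
  fix z assume "z \<in> carrier ?D"
  obtain k g where kg: "z = (k, g)" by force
  show "x \<otimes>\<^bsub>?D\<^esub> y \<otimes>\<^bsub>?D\<^esub> z = x \<otimes>\<^bsub>?D\<^esub> (y \<otimes>\<^bsub>?D\<^esub> z)"
    by (cases e; cases f; cases g)
      (simp_all add: dihedral_group_def ie jf kg mod_simps algebra_simps)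
qed

abbreviation Z2 :: "(int \<times> int) monoid" where
  "Z2 \<equiv> integer_group \<times>\<times> integer_group"

text \<open>The action of the dihedral group of order 8 on \<open>\<int>\<^sup>2\<close> in which one class of reflections, that of
  \<open>(0, True)\<close> (the image of \<open>t\<close>), swaps the coordinates and the other, that of
  \<open>(3, True)\<close> (the image of \<open>u\<close>), acts trivially; so the rotation \<open>(1, False)\<close>, which
  is the image of \<open>t u\<close>, swaps the coordinates.\<close>

definition D8_act :: "int \<times> bool \<Rightarrow> int \<times> int \<Rightarrow> int \<times> int" where
  "D8_act = (\<lambda>(i, e) (m, n). if even i = e then (n, m) else (m, n))"


section \<open>The group K\<close>

datatype K_gen = gA | gB | gT | gU

definition K_rels :: "(K_gen gword \<times> K_gen gword) set" where
  "K_rels =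
    {(gen gT @ gen gT, []),
     (gen gU @ gen gU, []),
     (concat (replicate 4 (gen gT @ gen gU)), []),
     (gen gA @ gen gB, gen gB @ gen gA),
     (gen_inv gT @ gen gA @ gen gT, gen gB),
     (gen_inv gU @ gen gA @ gen gU, gen gA),
     (gen_inv gU @ gen gB @ gen gU, gen gB)}"

type_synonym K_elt = "K_gen gword set"

definition K :: "K_elt monoid" where
  "K = presented_group K_rels"

definition K_a :: K_elt where "K_a = pres_class K_rels (gen gA)"
definition K_b :: K_elt where "K_b = pres_class K_rels (gen gB)"
definition K_t :: K_elt where "K_t = pres_class K_rels (gen gT)"
definition K_u :: K_elt where "K_u = pres_class K_rels (gen gU)"

definition K_Z :: "K_elt set" where
  "K_Z = {K_a, inv\<^bsub>K\<^esub> K_a, K_b, inv\<^bsub>K\<^esub> K_b, K_t, K_u}"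


section \<open>Geodesic and shortlex languages\<close>

text \<open>\<open>Z\<close> is a subset of the group \<open>G\<close> generating it as a monoid; words over \<open>Z\<close> are lists of
  elements of \<open>Z\<close>.\<close>

definition word_val :: "('g, 'm) monoid_scheme \<Rightarrow> 'g list \<Rightarrow> 'g" where
  "word_val G w = foldr (\<otimes>\<^bsub>G\<^esub>) w \<one>\<^bsub>G\<^esub>"

definition elt_length :: "('g, 'm) monoid_scheme \<Rightarrow> 'g set \<Rightarrow> 'g \<Rightarrow> nat" where
  "elt_length G Z g = (LEAST n. \<exists>w\<in>lists Z. word_val G w = g \<and> length w = n)"

definition conj_class :: "('g, 'm) monoid_scheme \<Rightarrow> 'g \<Rightarrow> 'g set" where
  "conj_class G g = {inv\<^bsub>G\<^esub> h \<otimes>\<^bsub>G\<^esub> g \<otimes>\<^bsub>G\<^esub> h | h. h \<in> carrier G}"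

definition conj_length :: "('g, 'm) monoid_scheme \<Rightarrow> 'g set \<Rightarrow> 'g \<Rightarrow> nat" where
  "conj_length G Z g = (LEAST n. \<exists>h\<in>conj_class G g. n = elt_length G Z h)"

definition Geo :: "('g, 'm) monoid_scheme \<Rightarrow> 'g set \<Rightarrow> 'g list set" where
  "Geo G Z = {w \<in> lists Z. length w = elt_length G Z (word_val G w)}"

definition ConjGeo :: "('g, 'm) monoid_scheme \<Rightarrow> 'g set \<Rightarrow> 'g list set" where
  "ConjGeo G Z = {w \<in> lists Z. length w = conj_length G Z (word_val G w)}"

text \<open>A strict linear order \<open>r\<close> on \<open>Z\<close> induces the shortlex order \<^const>\<open>lenlex\<close> on words.
  \<open>shortlex_least G Z r S\<close> is the least word representing an element of \<open>S\<close>.\<close>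

definition shortlex_least ::
  "('g, 'm) monoid_scheme \<Rightarrow> 'g set \<Rightarrow> 'g rel \<Rightarrow> 'g set \<Rightarrow> 'g list" where
  "shortlex_least G Z r S =
     (THE w. w \<in> lists Z \<and> word_val G w \<in> S \<and>
        (\<forall>v\<in>lists Z. word_val G v \<in> S \<longrightarrow> v = w \<or> (w, v) \<in> lenlex r))"

definition SL :: "('g, 'm) monoid_scheme \<Rightarrow> 'g set \<Rightarrow> 'g rel \<Rightarrow> 'g list set" where
  "SL G Z r = {shortlex_least G Z r {g} | g. g \<in> carrier G}"

definition ConjMinLenSL :: "('g, 'm) monoid_scheme \<Rightarrow> 'g set \<Rightarrow> 'g rel \<Rightarrow> 'g list set" where
  "ConjMinLenSL G Z r =
     {shortlex_least G Z r {g} | g. g \<in> carrier G \<and> elt_length G Z g = conj_length G Z g}"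

definition ConjSL :: "('g, 'm) monoid_scheme \<Rightarrow> 'g set \<Rightarrow> 'g rel \<Rightarrow> 'g list set" where
  "ConjSL G Z r = {shortlex_least G Z r (conj_class G g) | g. g \<in> carrier G}"


section \<open>Regular languages\<close>

text \<open>Acceptance by a deterministic finite automaton over the alphabet \<open>A\<close>. Any finite set of
  states can be renamed to a finite set of natural numbers.\<close>

definition regular_language :: "'a set \<Rightarrow> 'a list set \<Rightarrow> bool" where
  "regular_language A L \<longleftrightarrow> L \<subseteq> lists A \<and>
     (\<exists>(Q :: nat set) \<delta> q\<^sub>0 F.
        finite Q \<and> q\<^sub>0 \<in> Q \<and> F \<subseteq> Q \<and> (\<forall>q\<in>Q. \<forall>x\<in>A. \<delta> q x \<in> Q) \<and>
        (\<forall>w\<in>lists A. w \<in> L \<longleftrightarrow> foldl \<delta> q\<^sub>0 w \<in> F))"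

end

theory Submission
  imports Defs
begin

text \<open>In the coordinates \<open>((m, n), d)\<close> of the semidirect product a word is geodesic exactly when its
  length is \<open>\<bar>m\<bar> + \<bar>n\<bar> + \<bar>d\<bar>\<close>, where \<open>\<bar>d\<bar>\<close> is the length of \<open>d\<close> in the dihedral group: letters
  \<open>a\<close> and \<open>b\<close> can be collected in front, and no letter does better than moving one coordinate by 1. The
  signs of the coordinates and \<open>d\<close> then suffice to recognise geodesics. The shortlex normal forms are
  \<open>a\<^sup>m b\<^sup>n y\<close> with \<open>y\<close> one of eight words in \<open>t\<close> and \<open>u\<close>. The minimal length of a conjugate is
  \<open>\<bar>m\<bar> + \<bar>n\<bar>\<close> or \<open>\<bar>m + n\<bar>\<close>, depending on whether \<open>d\<close> fixes or swaps the coordinates, plus the minimal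
  length of a conjugate of \<open>d\<close>; whether a geodesic attains it is again visible from the signs. On the
  other hand \<open>(m, n)\<close> is conjugate in \<open>K\<close> only to itself and to \<open>(n, m)\<close>, so that for \<open>m, n \<ge> 0\<close> the
  word \<open>a\<^sup>m b\<^sup>n\<close> lies in \<open>ConjSL\<close> if and only if \<open>n \<le> m\<close>, which no finite automaton can check.\<close>

section \<open>Regular languages and left quotients\<close>

text \<open>The possible continuations of a prefix \<open>u\<close>. By the Myhill-Nerode
  construction these sets are the states of the minimal automaton.\<close>

definition left_quotient :: "'a set \<Rightarrow> 'a list set \<Rightarrow> 'a list \<Rightarrow> 'a list set" where
  "left_quotient A L u = {v \<in> lists A. u @ v \<in> L}"

abbreviation left_quotients :: "'a set \<Rightarrow> 'a list set \<Rightarrow> 'a list set set" where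
  "left_quotients A L \<equiv> left_quotient A L ` lists A"

text \<open>Myhill-Nerode. The quotient by a word is determined by the state which that word
  reaches; conversely the quotients themselves serve as states, numbered by an injection
  \<open>g\<close> because automata here have natural numbers as states.\<close>

lemma regular_language_iff_finite_quotients:
  "regular_language A L \<longleftrightarrow> L \<subseteq> lists A \<and> finite (left_quotients A L)"
proof
  assume "regular_language A L"
  then obtain Q :: "nat set" and \<delta> q0 F where L: "L \<subseteq> lists A" and fin: "finite Q"
    and q0: "q0 \<in> Q" and step: "\<forall>q\<in>Q. \<forall>x\<in>A. \<delta> q x \<in> Q"
    and acc: "\<forall>w\<in>lists A. w \<in> L \<longleftrightarrow> foldl \<delta> q0 w \<in> F"
    unfolding regular_language_def by blast
  have inQ: "foldl \<delta> q w \<in> Q" if "w \<in> lists A" "q \<in> Q" for w q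
    using that by (induction w arbitrary: q) (auto simp: step)
  have "left_quotient A L u = {v \<in> lists A. foldl \<delta> (foldl \<delta> q0 u) v \<in> F}" if "u \<in> lists A" for u
  proof -
    have "u @ v \<in> L \<longleftrightarrow> foldl \<delta> (foldl \<delta> q0 u) v \<in> F" if "v \<in> lists A" for v
      using acc \<open>u \<in> lists A\<close> that by (metis append_in_lists_conv foldl_append)
    then show ?thesis by (auto simp: left_quotient_def)
  qed
  then have "left_quotients A L \<subseteq> (\<lambda>q. {v \<in> lists A. foldl \<delta> q v \<in> F}) ` Q"
    using inQ[OF _ q0] by blast
  then show "L \<subseteq> lists A \<and> finite (left_quotients A L)"
    using L finite_surj[OF fin] by blast
next
  assume *: "L \<subseteq> lists A \<and> finite (left_quotients A L)"
  obtain g :: "'a list set \<Rightarrow> nat" where g: "inj_on g (left_quotients A L)"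
    using finite_imp_inj_to_nat_seg[OF conjunct2[OF *]] by auto
  \<comment> \<open>A state number is decoded to its quotient, which is then divided by one more
    letter.\<close>
  define \<delta> where "\<delta> q x = g (left_quotient A (inv_into (left_quotients A L) g q) [x])" for q x
  have \<delta>: "\<delta> (g (left_quotient A L u)) x = g (left_quotient A L (u @ [x]))"
    if "u \<in> lists A" "x \<in> A" for u x
  proof -
    have "left_quotient A (left_quotient A L u) [x] = left_quotient A L (u @ [x])"
      using that by (auto simp: left_quotient_def)
    then show ?thesis using that g by (simp add: \<delta>_def)
  qed
  have run: "foldl \<delta> (g (left_quotient A L u)) w = g (left_quotient A L (u @ w))"
    if "u \<in> lists A" "w \<in> lists A" for u w
    using that(2,1) by (induction w arbitrary: u) (auto simp: \<delta>)
  let ?F = "g ` {q \<in> left_quotients A L. [] \<in> q}"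
  have "w \<in> L \<longleftrightarrow> foldl \<delta> (g (left_quotient A L [])) w \<in> ?F" if "w \<in> lists A" for w
  proof -
    have "g (left_quotient A L w) \<in> ?F \<longleftrightarrow> [] \<in> left_quotient A L w"
      using that g by (auto simp: inj_on_def)
    then show ?thesis using that by (simp add: run) (simp add: left_quotient_def)
  qed
  moreover have "\<forall>q\<in>g ` left_quotients A L. \<forall>x\<in>A. \<delta> q x \<in> g ` left_quotients A L"
    using \<delta> by auto
  moreover have "?F \<subseteq> g ` left_quotients A L" by blast
  moreover have "g (left_quotient A L []) \<in> g ` left_quotients A L" by blast
  moreover have "finite (g ` left_quotients A L)" using * by simp
  ultimately have "\<exists>\<delta> q0 F. finite (g ` left_quotients A L) \<and> q0 \<in> g ` left_quotients A L \<and>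
      F \<subseteq> g ` left_quotients A L \<and>
      (\<forall>q\<in>g ` left_quotients A L. \<forall>x\<in>A. \<delta> q x \<in> g ` left_quotients A L) \<and>
      (\<forall>w\<in>lists A. w \<in> L \<longleftrightarrow> foldl \<delta> q0 w \<in> F)"
    by (intro exI[of _ \<delta>] exI[of _ "g (left_quotient A L [])"] exI[of _ ?F]) simp
  then show "regular_language A L"
    unfolding regular_language_def by (intro conjI conjunct1[OF *]) (rule exI)
qed

text \<open>\<open>f\<close> gives the state reached by a word, in an arbitrary type. The quotient
  by \<open>u\<close> depends only on \<open>f u\<close>, so finitely many values of
  \<open>f\<close> leave finitely many quotients.\<close>

lemma regular_languageI:
  assumes "L \<subseteq> lists A" "finite (f ` lists A)"
    and step: "\<And>w x. w \<in> lists A \<Longrightarrow> x \<in> A \<Longrightarrow> f (w @ [x]) = \<delta> (f w) x"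
    and acc: "\<And>w. w \<in> lists A \<Longrightarrow> w \<in> L \<longleftrightarrow> P (f w)"
  shows "regular_language A L"
proof -
  have run: "f (u @ v) = foldl \<delta> (f u) v" if "u \<in> lists A" "v \<in> lists A" for u v
    using that(2,1)
  proof (induction v arbitrary: u)
    case (Cons x v)
    then show ?case using Cons.IH[of "u @ [x]"] by (simp add: step)
  qed simp
  have "left_quotient A L u = {v \<in> lists A. P (foldl \<delta> (f u) v)}" if "u \<in> lists A" for u
  proof -
    have "u @ v \<in> L \<longleftrightarrow> P (foldl \<delta> (f u) v)" if "v \<in> lists A" for v
      using acc \<open>u \<in> lists A\<close> that by (simp flip: run)
    then show ?thesis by (auto simp: left_quotient_def)
  qed
  then have "left_quotients A L \<subseteq> (\<lambda>q. {v \<in> lists A. P (foldl \<delta> q v)}) ` f ` lists A"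
    by blast
  then have "finite (left_quotients A L)" by (rule finite_surj[OF assms(2)])
  then show ?thesis
    using assms(1) by (simp add: regular_language_iff_finite_quotients)
qed

text \<open>The product construction in terms of quotients.\<close>

lemma regular_language_combine:
  assumes "regular_language A L" "regular_language A M" and "N \<subseteq> lists A"
    and "\<And>u. u \<in> lists A \<Longrightarrow> left_quotient A N u = h (left_quotient A L u) (left_quotient A M u)"
  shows "regular_language A N"
proof -
  have "left_quotients A N \<subseteq> (\<lambda>(X, Y). h X Y) ` (left_quotients A L \<times> left_quotients A M)"
    using assms(4) by auto
  then show ?thesis
    using assms(1-3) unfolding regular_language_iff_finite_quotients
    by (meson finite_SigmaI finite_surj)
qed

lemma regular_language_Un:
  assumes "regular_language A L" "regular_language A M"
  shows "regular_language A (L \<union> M)"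
  using assms by (intro regular_language_combine[OF assms, where h = "(\<union>)"])
    (auto simp: left_quotient_def regular_language_iff_finite_quotients)

lemma regular_language_Int:
  assumes "regular_language A L" "regular_language A M"
  shows "regular_language A (L \<inter> M)"
  using assms by (intro regular_language_combine[OF assms, where h = "(\<inter>)"])
    (auto simp: left_quotient_def regular_language_iff_finite_quotients)

lemma regular_language_finite:
  assumes "finite L" "L \<subseteq> lists A"
  shows "regular_language A L"
proof -
  \<comment> \<open>Every word in a quotient is a word of \<open>L\<close> with a prefix dropped, so
    all quotients are subsets of one finite set.\<close>
  have "left_quotients A L \<subseteq> Pow ((\<lambda>(n, w). drop n w) ` (SIGMA n:{..Max (length ` L)}. L))"
  proof clarify
    fix u v assume "v \<in> left_quotient A L u"
    then have uv: "u @ v \<in> L" by (simp add: left_quotient_def)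
    then have "length (u @ v) \<le> Max (length ` L)"
      using assms by (intro Max_ge imageI finite_imageI)
    then have "(length u, u @ v) \<in> (SIGMA n:{..Max (length ` L)}. L)" using uv by auto
    then show "v \<in> (\<lambda>(n, w). drop n w) ` (SIGMA n:{..Max (length ` L)}. L)"
      by (force simp: image_iff)
  qed
  then have "finite (left_quotients A L)" by (rule finite_subset) (use assms in simp)
  then show ?thesis using assms by (simp add: regular_language_iff_finite_quotients)
qed

lemma regular_language_powers:
  assumes "x \<in> A"
  shows "regular_language A (range (\<lambda>n. replicate n x))"
proof -
  let ?L = "range (\<lambda>n. replicate n x)"
  have mem: "w \<in> ?L \<longleftrightarrow> set w \<subseteq> {x}" for w
    by (auto simp: replicate_length_same[symmetric] subset_singleton_iff
        intro!: range_eqI[of _ _ "length w"] replicate_eqI)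
  \<comment> \<open>A prefix containing a letter other than \<open>x\<close> has no continuation;
    after any other prefix exactly the powers of \<open>x\<close> remain.\<close>
  have "left_quotient A ?L u \<in> {?L, {}}" for u
    using assms mem by (cases "set u \<subseteq> {x}") (auto simp: left_quotient_def in_lists_conv_set)
  then have "left_quotients A ?L \<subseteq> {?L, {}}" by blast
  moreover have "?L \<subseteq> lists A" using assms by auto
  ultimately show ?thesis
    unfolding regular_language_iff_finite_quotients by (meson finite.simps finite_subset)
qed

text \<open>If \<open>u @ z = v @ w\<close>, one of \<open>u\<close> and \<open>v\<close> is a
  prefix of the other. Hence the quotient by \<open>u\<close> is determined by the quotient of
  \<open>L\<close> by \<open>u\<close> and a set of quotients of \<open>M\<close>, as in the subset
  construction.\<close>

lemma regular_language_conc: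
  assumes L: "regular_language A L" and M: "regular_language A M"
  shows "regular_language A {v @ w |v w. v \<in> L \<and> w \<in> M}"
proof -
  let ?N = "{v @ w |v w. v \<in> L \<and> w \<in> M}"
  let ?h = "\<lambda>(X, \<Y>). {v @ w |v w. v \<in> X \<and> w \<in> M} \<union> \<Union>\<Y>"
  have sub: "L \<subseteq> lists A" "M \<subseteq> lists A"
    and fin: "finite (left_quotients A L)" "finite (left_quotients A M)"
    using L M by (auto simp: regular_language_iff_finite_quotients)
  have "left_quotient A ?N u \<in> ?h ` (left_quotients A L \<times> Pow (left_quotients A M))" if u: "u \<in> lists A" for u
  proof -
    \<comment> \<open>One quotient of \<open>M\<close> for each way of cutting off from
      \<open>u\<close> a prefix that lies in \<open>L\<close>.\<close>
    let ?Y = "left_quotient A M ` {q. \<exists>p\<in>L. u = p @ q}"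
    have "left_quotient A ?N u = {v @ w |v w. v \<in> left_quotient A L u \<and> w \<in> M} \<union> \<Union>?Y"
    proof (intro equalityI subsetI)
      fix z assume "z \<in> left_quotient A ?N u"
      then obtain v w where *: "z \<in> lists A" "u @ z = v @ w" "v \<in> L" "w \<in> M"
        by (auto simp: left_quotient_def)
      from *(2) consider p where "v = u @ p" "z = p @ w" | q where "u = v @ q" "w = q @ z"
        by (auto simp: append_eq_append_conv2)
      then show "z \<in> {v @ w |v w. v \<in> left_quotient A L u \<and> w \<in> M} \<union> \<Union>?Y"
        using * by cases (auto simp: left_quotient_def)
    next
      fix z assume "z \<in> {v @ w |v w. v \<in> left_quotient A L u \<and> w \<in> M} \<union> \<Union>?Y"
      then consider v w where "z = v @ w" "v \<in> left_quotient A L u" "w \<in> M"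
        | p q where "u = p @ q" "p \<in> L" "z \<in> left_quotient A M q" by auto
      then show "z \<in> left_quotient A ?N u"
      proof cases
        case 1
        then have "u @ z = (u @ v) @ w" "u @ v \<in> L" "z \<in> lists A"
          using sub by (auto simp: left_quotient_def)
        then show ?thesis using 1 unfolding left_quotient_def by blast
      next
        case 2
        then show ?thesis by (auto simp: left_quotient_def)
      qed
    qed
    moreover have "?Y \<subseteq> left_quotients A M" using u by auto
    ultimately show ?thesis using u by (intro image_eqI[where x = "(left_quotient A L u, ?Y)"]) auto
  qed
  then have "left_quotients A ?N \<subseteq> ?h ` (left_quotients A L \<times> Pow (left_quotients A M))" by blast
  moreover have "finite (?h ` (left_quotients A L \<times> Pow (left_quotients A M)))" using fin by simp
  moreover have "v @ w \<in> lists A" if "v \<in> L" "w \<in> M" for v w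
    using subsetD[OF sub(1) that(1)] subsetD[OF sub(2) that(2)] by simp
  then have "?N \<subseteq> lists A" by blast
  ultimately show ?thesis
    unfolding regular_language_iff_finite_quotients by (meson finite_subset)
qed

section \<open>Shortlex minima\<close>

lemma total_on_lenlex:
  assumes "total_on Z r"
  shows "total_on (lists Z) (lenlex r)"
proof (rule total_onI)
  fix v w assume "v \<in> lists Z" "w \<in> lists Z" "v \<noteq> w"
  then show "(v, w) \<in> lenlex r \<or> (w, v) \<in> lenlex r"
  proof (induction v arbitrary: w)
    case (Cons x v)
    show ?case
    proof (cases w)
      case w: (Cons y w')
      have xy: "x \<in> Z" "y \<in> Z" using Cons.hyps Cons.prems(1) w by auto
      have w': "w' \<in> lists Z" using Cons.prems(1) w by auto
      show ?thesis
      proof (cases "x = y")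
        case True
        then show ?thesis using Cons.IH[OF w'] Cons.prems(2) w by (auto simp: Cons_lenlex_iff)
      next
        case False
        then show ?thesis
          using assms xy unfolding total_on_def w Cons_lenlex_iff by (meson linorder_neqE_nat)
      qed
    qed simp
  qed simp
qed

lemma lenlex_mono: "r \<subseteq> s \<Longrightarrow> (v, w) \<in> lenlex r \<Longrightarrow> (v, w) \<in> lenlex s"
proof (induction v arbitrary: w)
  case (Cons x v)
  then show ?case by (cases w) (auto simp: Cons_lenlex_iff)
qed simp

lemma shortlex_least_eqI:
  assumes "trans r" "irrefl r" "w \<in> lists Z" "word_val G w \<in> S"
    and "\<And>v. v \<in> lists Z \<Longrightarrow> word_val G v \<in> S \<Longrightarrow> v = w \<or> (w, v) \<in> lenlex r"
  shows "shortlex_least G Z r S = w"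
  unfolding shortlex_least_def
proof (rule the_equality)
  fix w'
  assume w': "w' \<in> lists Z \<and> word_val G w' \<in> S \<and>
    (\<forall>v\<in>lists Z. word_val G v \<in> S \<longrightarrow> v = w' \<or> (w', v) \<in> lenlex r)"
  show "w' = w"
  proof (rule ccontr)
    assume "w' \<noteq> w"
    then have "(w', w) \<in> lenlex r" "(w, w') \<in> lenlex r" using w' assms(3-5) by blast+
    then have "(w, w) \<in> lenlex r" using lenlex_trans assms(1) by blast
    then show False using lenlex_irreflexive assms(2) unfolding irrefl_def by blast
  qed
qed (use assms in blast)

lemma shortlex_least_works:
  assumes "finite Z" "strict_linear_order_on Z r" "u \<in> lists Z" "word_val G u \<in> S"
  shows "shortlex_least G Z r S \<in> lists Z \<and> word_val G (shortlex_least G Z r S) \<in> S \<and>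
    (\<forall>v\<in>lists Z. word_val G v \<in> S \<longrightarrow>
       v = shortlex_least G Z r S \<or> (shortlex_least G Z r S, v) \<in> lenlex r)"
proof -
  \<comment> \<open>Cut down to the finite set \<open>Z\<close>, the order is finite and acyclic,
    hence well-founded, and so is its \<open>lenlex\<close>; outside \<open>Z\<close> nothing of
    this kind is known about \<open>r\<close>.\<close>
  let ?r = "r \<inter> Z \<times> Z" and ?W = "{w \<in> lists Z. word_val G w \<in> S}"
  have r: "trans r" "irrefl r" "total_on Z r"
    using assms(2) by (auto simp: strict_linear_order_on_def)
  have "trans ?r" using r(1) by (auto simp: trans_def)
  moreover have "irrefl ?r" using r(2) by (auto simp: irrefl_def)
  ultimately have "acyclic ?r" by (simp add: acyclic_irrefl trancl_id)
  moreover have "finite ?r" using assms(1) by simp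
  ultimately have wf: "wf (lenlex ?r)" by (simp add: finite_acyclic_wf wf_lenlex)
  have "u \<in> ?W" using assms(3,4) by blast
  then have "\<exists>w\<in>?W. \<forall>v. (v, w) \<in> lenlex ?r \<longrightarrow> v \<notin> ?W"
    using wf unfolding wf_eq_minimal by meson
  then obtain w where w: "w \<in> ?W" "\<forall>v. (v, w) \<in> lenlex ?r \<longrightarrow> v \<notin> ?W"
    by (elim bexE)
  have "total_on (lists Z) (lenlex ?r)"
    using r(3) by (intro total_on_lenlex) (simp add: total_on_def)
  then have least: "v = w \<or> (w, v) \<in> lenlex r" if "v \<in> lists Z" "word_val G v \<in> S" for v
    using w that lenlex_mono[of ?r r w v] unfolding total_on_def by blast
  have "shortlex_least G Z r S = w"
    using r w least by (intro shortlex_least_eqI) auto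
  then show ?thesis using w least by blast
qed

section \<open>The semidirect product as a model of K\<close>

abbreviation Z2D8 :: "((int \<times> int) \<times> (int \<times> bool)) monoid" where
  "Z2D8 \<equiv> semidirect_product Z2 (dihedral_group 4) D8_act"

text \<open>The residues modulo 4 are enumerated so that membership splits into four cases.\<close>

definition rots :: "int set" where "rots = {0, 1, 2, 3}"

lemma carrier_Z2D8: "carrier Z2D8 = UNIV \<times> (rots \<times> UNIV)"
  by (auto simp: semidirect_product_def dihedral_group_def rots_def)

text \<open>The parity of the number of letters \<open>t\<close> in a word for the element: the
  homomorphism onto the group of order 2 through which the dihedral group acts.\<close>

definition swaps :: "int \<times> bool \<Rightarrow> bool" where "swaps = (\<lambda>(i, e). even i = e)"

lemma mult_Z2D8 [simp]:
  "((m, n), d) \<otimes>\<^bsub>Z2D8\<^esub> ((m', n'), d') =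
     (if swaps d then (m + n', n + m') else (m + m', n + n'), d \<otimes>\<^bsub>dihedral_group 4\<^esub> d')"
  by (cases d) (simp add: semidirect_product_def D8_act_def swaps_def integer_group_def)

lemma one_Z2D8 [simp]: "\<one>\<^bsub>Z2D8\<^esub> = ((0, 0), (0, False))"
  by (simp add: semidirect_product_def dihedral_group_def integer_group_def)

lemma mult_D8: "(i, e) \<otimes>\<^bsub>dihedral_group 4\<^esub> (j, f) = ((if e then i - j else i + j) mod 4, e \<noteq> f)"
  by (simp add: dihedral_group_def)

lemma swaps_mult [simp]: "swaps (d \<otimes>\<^bsub>dihedral_group 4\<^esub> d') \<longleftrightarrow> swaps d \<noteq> swaps d'"
proof -
  have "even (k mod 4) = even k" for k :: int by presburger
  then show ?thesis by (cases d; cases d') (auto simp: mult_D8 swaps_def)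
qed

lemma carrier_D8: "carrier (dihedral_group 4) = rots \<times> UNIV"
  by (auto simp: dihedral_group_def rots_def)

interpretation D8: group "dihedral_group 4"
  by (rule dihedral_group_is_group) simp

lemma Z2D8_group: "group Z2D8"
proof (rule groupI)
  fix x assume "x \<in> carrier Z2D8"
  then obtain m n d where x: "x = ((m, n), d)" and d: "d \<in> carrier (dihedral_group 4)"
    by (cases x) (auto simp: carrier_Z2D8 carrier_D8)
  have one: "\<one>\<^bsub>dihedral_group 4\<^esub> = (0, False)" by (simp add: dihedral_group_def)
  show "\<one>\<^bsub>Z2D8\<^esub> \<otimes>\<^bsub>Z2D8\<^esub> x = x"
    using D8.l_one[OF d] by (simp add: x one) (simp add: swaps_def)
  \<comment> \<open>The inverse of \<open>(v, d)\<close> has second component the inverse of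
    \<open>d\<close>, and first component minus the image of \<open>v\<close> under that
    inverse.\<close>
  show "\<exists>y\<in>carrier Z2D8. y \<otimes>\<^bsub>Z2D8\<^esub> x = \<one>\<^bsub>Z2D8\<^esub>"
    using D8.inv_closed[OF d] D8.l_inv[OF d]
    by (intro bexI[of _ "(if swaps (inv\<^bsub>dihedral_group 4\<^esub> d) then (-n, -m) else (-m, -n), inv\<^bsub>dihedral_group 4\<^esub> d)"])
     (auto simp: x one carrier_Z2D8 carrier_D8)
  fix y assume "y \<in> carrier Z2D8"
  then obtain m' n' d' where y: "y = ((m', n'), d')" and d': "d' \<in> carrier (dihedral_group 4)"
    by (cases y) (auto simp: carrier_Z2D8 carrier_D8)
  show "x \<otimes>\<^bsub>Z2D8\<^esub> y \<in> carrier Z2D8"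
    using D8.m_closed[OF d d'] by (simp add: x y carrier_Z2D8 carrier_D8)
  fix z assume "z \<in> carrier Z2D8"
  then obtain m'' n'' d'' where z: "z = ((m'', n''), d'')" and d'': "d'' \<in> carrier (dihedral_group 4)"
    by (cases z) (auto simp: carrier_Z2D8 carrier_D8)
  show "x \<otimes>\<^bsub>Z2D8\<^esub> y \<otimes>\<^bsub>Z2D8\<^esub> z = x \<otimes>\<^bsub>Z2D8\<^esub> (y \<otimes>\<^bsub>Z2D8\<^esub> z)"
    using D8.m_assoc[OF d d' d''] by (simp add: x y z)
qed (simp add: carrier_Z2D8 rots_def)

interpretation H: group Z2D8 by (rule Z2D8_group)

text \<open>The exponent sign is ignored for \<open>gT\<close> and \<open>gU\<close> because their
  images are involutions.\<close>

fun gen_val :: "K_gen \<times> bool \<Rightarrow> (int \<times> int) \<times> (int \<times> bool)" where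
  "gen_val (gA, e) = ((if e then 1 else - 1, 0), (0, False))"
| "gen_val (gB, e) = ((0, if e then 1 else - 1), (0, False))"
| "gen_val (gT, e) = ((0, 0), (0, True))"
| "gen_val (gU, e) = ((0, 0), (3, True))"

lemma gen_val_carrier: "gen_val l \<in> carrier Z2D8"
  by (cases l rule: gen_val.cases) (auto simp: carrier_Z2D8 rots_def)

definition gword_val :: "K_gen gword \<Rightarrow> (int \<times> int) \<times> (int \<times> bool)" where
  "gword_val w = word_val Z2D8 (map gen_val w)"

lemma gword_val_Nil: "gword_val [] = \<one>\<^bsub>Z2D8\<^esub>"
  and gword_val_Cons: "gword_val (l # w) = gen_val l \<otimes>\<^bsub>Z2D8\<^esub> gword_val w"
  by (simp_all add: gword_val_def word_val_def)

lemma gword_val_carrier: "gword_val w \<in> carrier Z2D8"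
  by (induction w) (auto simp: gword_val_Nil gword_val_Cons gen_val_carrier simp del: one_Z2D8)

lemma gword_val_append: "gword_val (v @ w) = gword_val v \<otimes>\<^bsub>Z2D8\<^esub> gword_val w"
proof (induction v)
  case Nil
  show ?case using H.l_one[OF gword_val_carrier] by (simp add: gword_val_Nil del: one_Z2D8)
next
  case (Cons l v)
  then show ?case
    by (simp add: gword_val_Cons H.m_assoc gen_val_carrier gword_val_carrier)
qed

lemma replicate_4: "replicate 4 x = [x, x, x, x]"
  by (simp add: numeral_eq_Suc)

text \<open>The images of the generators satisfy the defining relations, so evaluation factors
  through the presentation.\<close>

lemma gword_val_cong:
  assumes "pres_eq K_rels v w" shows "gword_val v = gword_val w"
  using assms
proof induction
  case (cancel x e)
  show ?case
    by (cases x) (simp_all add: gword_val_Nil gword_val_Cons swaps_def mult_D8)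
next
  case (rel v w)
  then show ?case
    by (auto simp: K_rels_def replicate_4 gword_val_Nil gword_val_Cons swaps_def mult_D8)
qed (simp_all add: gword_val_append)

section \<open>The presented group and its defining relations\<close>

interpretation K: group K
  unfolding K_def by (rule presented_group_is_group)

lemma carrier_K: "carrier K = range (pres_class K_rels)"
  and one_K: "\<one>\<^bsub>K\<^esub> = pres_class K_rels []"
  by (simp_all add: K_def presented_group_def)

lemma pres_class_carrier [simp]: "pres_class K_rels w \<in> carrier K"
  by (simp add: carrier_K)

lemma mult_K: "pres_class K_rels v \<otimes>\<^bsub>K\<^esub> pres_class K_rels w = pres_class K_rels (v @ w)"
  by (simp add: K_def)

lemma inv_gen: "inv\<^bsub>K\<^esub> pres_class K_rels (gen x) = pres_class K_rels (gen_inv x)"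
  using pres_eq.cancel[of K_rels x False]
  by (intro K.inv_equality) (simp_all add: mult_K one_K pres_class_eq_iff)

lemma gens_carrier [simp]:
  "K_a \<in> carrier K" "K_b \<in> carrier K" "K_t \<in> carrier K" "K_u \<in> carrier K"
  by (simp_all add: K_a_def K_b_def K_t_def K_u_def)

lemma K_relation: "(v, w) \<in> K_rels \<Longrightarrow> pres_class K_rels v = pres_class K_rels w"
  by (simp add: pres_class_eq_iff pres_eq.rel)

lemma K_presentation:
  shows K_tt: "K_t \<otimes>\<^bsub>K\<^esub> K_t = \<one>\<^bsub>K\<^esub>"
    and K_uu: "K_u \<otimes>\<^bsub>K\<^esub> K_u = \<one>\<^bsub>K\<^esub>"
    and K_tutu: "K_t \<otimes>\<^bsub>K\<^esub> (K_u \<otimes>\<^bsub>K\<^esub> (K_t \<otimes>\<^bsub>K\<^esub> (K_u \<otimes>\<^bsub>K\<^esub>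
      (K_t \<otimes>\<^bsub>K\<^esub> (K_u \<otimes>\<^bsub>K\<^esub> (K_t \<otimes>\<^bsub>K\<^esub> K_u)))))) = \<one>\<^bsub>K\<^esub>"
    and K_ab: "K_a \<otimes>\<^bsub>K\<^esub> K_b = K_b \<otimes>\<^bsub>K\<^esub> K_a"
    and K_at: "inv\<^bsub>K\<^esub> K_t \<otimes>\<^bsub>K\<^esub> (K_a \<otimes>\<^bsub>K\<^esub> K_t) = K_b"
    and K_au: "inv\<^bsub>K\<^esub> K_u \<otimes>\<^bsub>K\<^esub> (K_a \<otimes>\<^bsub>K\<^esub> K_u) = K_a"
    and K_bu: "inv\<^bsub>K\<^esub> K_u \<otimes>\<^bsub>K\<^esub> (K_b \<otimes>\<^bsub>K\<^esub> K_u) = K_b"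
  by (simp_all add: K_a_def K_b_def K_t_def K_u_def inv_gen mult_K one_K,
      rule_tac [!] K_relation) (simp_all add: K_rels_def replicate_4)

section \<open>Normal forms\<close>

text \<open>The hypothesis says that conjugation by \<open>x\<close> carries \<open>y\<close> to
  \<open>z\<close>; it then carries powers to powers.\<close>

lemma (in group) int_pow_conj:
  assumes "x \<in> carrier G" "y \<in> carrier G" "z \<in> carrier G" "x \<otimes> y = z \<otimes> x"
  shows "x \<otimes> y [^] (k :: int) = z [^] k \<otimes> x"
proof -
  have nat: "x \<otimes> y [^] n = z [^] n \<otimes> x" for n :: nat
  proof (induction n)
    case (Suc n)
    have "x \<otimes> (y [^] n \<otimes> y) = (z [^] n \<otimes> x) \<otimes> y"
      using assms Suc by (simp flip: m_assoc)
    then show ?case using assms by (simp add: m_assoc)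
  qed (use assms in simp)
  show ?thesis
  proof (cases "k < 0")
    case True
    let ?n = "nat (- k)"
    \<comment> \<open>For a negative exponent, the identity for the positive power is multiplied by
      the inverse powers from both sides.\<close>
    have "inv (z [^] ?n) \<otimes> (z [^] ?n \<otimes> x) \<otimes> inv (y [^] ?n) = x \<otimes> inv (y [^] ?n)"
      using assms by (simp flip: m_assoc)
    moreover have "inv (z [^] ?n) \<otimes> (x \<otimes> y [^] ?n) \<otimes> inv (y [^] ?n) = inv (z [^] ?n) \<otimes> x"
      using assms by (simp add: m_assoc)
    ultimately have "x \<otimes> inv (y [^] ?n) = inv (z [^] ?n) \<otimes> x" by (simp only: nat)
    then show ?thesis using True by (simp only: int_pow_def2 if_True)
  qed (simp only: int_pow_def2 if_False nat)
qed

lemma (in monoid) word_val_simps [simp]: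
  "word_val G [] = \<one>" "word_val G (x # w) = x \<otimes> word_val G w"
  by (simp_all add: word_val_def)

lemma (in monoid) word_val_closed: "set w \<subseteq> carrier G \<Longrightarrow> word_val G w \<in> carrier G"
  by (induction w) auto

lemma (in monoid) word_val_append:
  "set v \<subseteq> carrier G \<Longrightarrow> set w \<subseteq> carrier G \<Longrightarrow>
    word_val G (v @ w) = word_val G v \<otimes> word_val G w"
  by (induction v) (simp_all add: m_assoc word_val_closed)

lemma (in group) word_val_replicate:
  "x \<in> carrier G \<Longrightarrow> word_val G (replicate n x) = x [^] n"
  by (induction n) (use nat_pow_Suc2[of x] in auto)

definition power_word :: "K_elt \<Rightarrow> int \<Rightarrow> K_elt list" where
  "power_word x m = (if 0 \<le> m then replicate (nat m) x else replicate (nat (- m)) (inv\<^bsub>K\<^esub> x))"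

text \<open>The shortlex least words in \<open>t < u\<close> for the eight dihedral elements. Only
  the central rotation \<open>(2, False)\<close> has two shortest words, \<open>t u t u\<close> and
  \<open>u t u t\<close>.\<close>

definition tu_word :: "int \<times> bool \<Rightarrow> K_elt list" where
  "tu_word = (\<lambda>(i, e).
     if e then (if i = 0 then [K_t] else if i = 1 then [K_t, K_u, K_t]
                else if i = 2 then [K_u, K_t, K_u] else [K_u])
     else (if i = 0 then [] else if i = 1 then [K_t, K_u]
           else if i = 2 then [K_t, K_u, K_t, K_u] else [K_u, K_t]))"

definition nf :: "(int \<times> int) \<times> (int \<times> bool) \<Rightarrow> K_elt list" where
  "nf = (\<lambda>((m, n), d). power_word K_a m @ power_word K_b n @ tu_word d)"

lemma set_power_word: "set (power_word x m) \<subseteq> {x, inv\<^bsub>K\<^esub> x}"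
  by (auto simp: power_word_def)

lemma tu_word_lists: "tu_word d \<in> lists K_Z"
  by (cases d) (simp add: tu_word_def K_Z_def)

lemma power_word_lists: "power_word K_a m \<in> lists K_Z" "power_word K_b m \<in> lists K_Z"
  by (auto simp: power_word_def K_Z_def)

lemma nf_lists: "nf h \<in> lists K_Z"
proof -
  have "nf ((m, n), d) \<in> lists K_Z" for m n d
    unfolding nf_def prod.case append_in_lists_conv using tu_word_lists power_word_lists by blast
  then show ?thesis by (metis prod.exhaust)
qed

lemma K_Z_carrier: "K_Z \<subseteq> carrier K"
  by (auto simp: K_Z_def)

lemma word_val_power_word: "x \<in> carrier K \<Longrightarrow> word_val K (power_word x m) = x [^]\<^bsub>K\<^esub> m"
  unfolding power_word_def int_pow_def2
  by (cases "m < 0") (simp_all add: K.word_val_replicate K.int_pow_inv)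

lemma set_tu_word: "set (tu_word d) \<subseteq> carrier K"
  by (cases d) (simp add: tu_word_def)

lemma word_val_nf:
  "word_val K (nf ((m, n), d)) =
     K_a [^]\<^bsub>K\<^esub> m \<otimes>\<^bsub>K\<^esub> (K_b [^]\<^bsub>K\<^esub> n \<otimes>\<^bsub>K\<^esub> word_val K (tu_word d))"
proof -
  have "set (power_word x k) \<subseteq> carrier K" if "x \<in> carrier K" for x k
    using set_power_word[of x k] that by auto
  then show ?thesis
    by (simp add: nf_def K.word_val_append set_tu_word word_val_power_word)
qed

lemma K_commutation:
  shows K_ta: "K_t \<otimes>\<^bsub>K\<^esub> K_a = K_b \<otimes>\<^bsub>K\<^esub> K_t"
    and K_tb: "K_t \<otimes>\<^bsub>K\<^esub> K_b = K_a \<otimes>\<^bsub>K\<^esub> K_t"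
    and K_ua: "K_u \<otimes>\<^bsub>K\<^esub> K_a = K_a \<otimes>\<^bsub>K\<^esub> K_u"
    and K_ub: "K_u \<otimes>\<^bsub>K\<^esub> K_b = K_b \<otimes>\<^bsub>K\<^esub> K_u"
proof -
  have inv: "inv\<^bsub>K\<^esub> K_t = K_t" by (simp add: K.inv_equality K_tt)
  show "K_t \<otimes>\<^bsub>K\<^esub> K_a = K_b \<otimes>\<^bsub>K\<^esub> K_t"
    using K_at by (simp add: inv) (metis K.inv_solve_right gens_carrier inv K.m_assoc K.m_closed)
  show "K_t \<otimes>\<^bsub>K\<^esub> K_b = K_a \<otimes>\<^bsub>K\<^esub> K_t"
    using K_at by (metis K.inv_solve_left gens_carrier K.m_closed)
  show "K_u \<otimes>\<^bsub>K\<^esub> K_a = K_a \<otimes>\<^bsub>K\<^esub> K_u"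
    using K_au by (metis K.inv_solve_left gens_carrier K.m_closed)
  show "K_u \<otimes>\<^bsub>K\<^esub> K_b = K_b \<otimes>\<^bsub>K\<^esub> K_u"
    using K_bu by (metis K.inv_solve_left gens_carrier K.m_closed)
qed

lemma K_cancel:
  assumes "x \<in> carrier K"
  shows K_ttx: "K_t \<otimes>\<^bsub>K\<^esub> (K_t \<otimes>\<^bsub>K\<^esub> x) = x" and K_uux: "K_u \<otimes>\<^bsub>K\<^esub> (K_u \<otimes>\<^bsub>K\<^esub> x) = x"
  using assms by (simp_all add: K_tt K_uu flip: K.m_assoc)

text \<open>By the relation of length 8, \<open>t u t u\<close> is an involution and so equals its
  inverse \<open>u t u t\<close>.\<close>

lemma K_braid: "K_u \<otimes>\<^bsub>K\<^esub> (K_t \<otimes>\<^bsub>K\<^esub> (K_u \<otimes>\<^bsub>K\<^esub> K_t)) = K_t \<otimes>\<^bsub>K\<^esub> (K_u \<otimes>\<^bsub>K\<^esub> (K_t \<otimes>\<^bsub>K\<^esub> K_u))"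
proof -
  let ?x = "K_t \<otimes>\<^bsub>K\<^esub> (K_u \<otimes>\<^bsub>K\<^esub> (K_t \<otimes>\<^bsub>K\<^esub> K_u))"
  have "?x \<otimes>\<^bsub>K\<^esub> ?x = \<one>\<^bsub>K\<^esub>" using K_tutu by (simp add: K.m_assoc)
  then have "inv\<^bsub>K\<^esub> ?x = ?x" by (simp add: K.inv_equality)
  moreover have "inv\<^bsub>K\<^esub> K_t = K_t" "inv\<^bsub>K\<^esub> K_u = K_u"
    by (simp_all add: K.inv_equality K_tt K_uu)
  ultimately show ?thesis by (simp add: K.inv_mult_group K.m_assoc)
qed

lemma tu_word_mult:
  assumes "d \<in> carrier (dihedral_group 4)"
  shows "K_t \<otimes>\<^bsub>K\<^esub> word_val K (tu_word d) = word_val K (tu_word ((0, True) \<otimes>\<^bsub>dihedral_group 4\<^esub> d))"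
    and "K_u \<otimes>\<^bsub>K\<^esub> word_val K (tu_word d) = word_val K (tu_word ((3, True) \<otimes>\<^bsub>dihedral_group 4\<^esub> d))"
proof -
  \<comment> \<open>The braid relation turns \<open>t u t u\<close> into \<open>u t u t\<close>,
    whose first letter cancels.\<close>
  have *: "K_u \<otimes>\<^bsub>K\<^esub> (K_t \<otimes>\<^bsub>K\<^esub> (K_u \<otimes>\<^bsub>K\<^esub> (K_t \<otimes>\<^bsub>K\<^esub> K_u))) = K_t \<otimes>\<^bsub>K\<^esub> (K_u \<otimes>\<^bsub>K\<^esub> K_t)"
    by (simp add: K_cancel flip: K_braid)
  obtain i e where d: "d = (i, e)" "i \<in> rots" using assms by (cases d) (auto simp: carrier_D8)
  show "K_t \<otimes>\<^bsub>K\<^esub> word_val K (tu_word d) = word_val K (tu_word ((0, True) \<otimes>\<^bsub>dihedral_group 4\<^esub> d))"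
    using d(2) by (auto simp: d(1) rots_def tu_word_def mult_D8 K_cancel K_tt K_uu)
  show "K_u \<otimes>\<^bsub>K\<^esub> word_val K (tu_word d) = word_val K (tu_word ((3, True) \<otimes>\<^bsub>dihedral_group 4\<^esub> d))"
    using d(2) by (auto simp: d(1) rots_def tu_word_def mult_D8 K_cancel K_tt K_uu K_braid *)
qed

lemma K_letter:
  "pres_class K_rels [(gA, e)] = K_a [^]\<^bsub>K\<^esub> (if e then 1 else - 1 :: int)"
  "pres_class K_rels [(gB, e)] = K_b [^]\<^bsub>K\<^esub> (if e then 1 else - 1 :: int)"
  "pres_class K_rels [(gT, e)] = K_t" "pres_class K_rels [(gU, e)] = K_u"
proof -
  have "inv\<^bsub>K\<^esub> K_t = K_t" "inv\<^bsub>K\<^esub> K_u = K_u"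
    by (simp_all add: K.inv_equality K_tt K_uu)
  then show "pres_class K_rels [(gA, e)] = K_a [^]\<^bsub>K\<^esub> (if e then 1 else - 1 :: int)"
    "pres_class K_rels [(gB, e)] = K_b [^]\<^bsub>K\<^esub> (if e then 1 else - 1 :: int)"
    "pres_class K_rels [(gT, e)] = K_t" "pres_class K_rels [(gU, e)] = K_u"
    by (cases e; simp add: K_a_def K_b_def K_t_def K_u_def inv_gen K.int_pow_neg)+
qed

text \<open>Letters \<open>a\<close> and \<open>b\<close> are absorbed into their own power. A
  letter \<open>t\<close> passes both powers and exchanges them, a letter \<open>u\<close> passes
  them unchanged, and both end up multiplying the dihedral tail.\<close>

lemma letter_mult_nf:
  assumes "h \<in> carrier Z2D8"
  shows "pres_class K_rels [l] \<otimes>\<^bsub>K\<^esub> word_val K (nf h) = word_val K (nf (gen_val l \<otimes>\<^bsub>Z2D8\<^esub> h))"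
proof -
  obtain m n d where h: "h = ((m, n), d)" and d: "d \<in> carrier (dihedral_group 4)"
    using assms by (cases h) (auto simp: carrier_Z2D8 carrier_D8)
  obtain x e where l: "l = (x, e)" by force
  let ?Y = "word_val K (tu_word d)"
  have Y: "?Y \<in> carrier K" by (rule K.word_val_closed[OF set_tu_word])
  have d1: "(0, False) \<otimes>\<^bsub>dihedral_group 4\<^esub> d = d"
    using D8.l_one[OF d] by (simp add: dihedral_group_def)
  let ?s = "if e then 1 else - 1 :: int"
  let ?A = "\<lambda>k :: int. K_a [^]\<^bsub>K\<^esub> k" and ?B = "\<lambda>k :: int. K_b [^]\<^bsub>K\<^esub> k"
  have AB: "?B k \<otimes>\<^bsub>K\<^esub> ?A j = ?A j \<otimes>\<^bsub>K\<^esub> ?B k" for j k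
    using K.int_pow_conj[of "?B k" K_a K_a j] K.int_pow_conj[of K_a K_b K_b k] by (simp add: K_ab)
  have T: "K_t \<otimes>\<^bsub>K\<^esub> ?A k = ?B k \<otimes>\<^bsub>K\<^esub> K_t" "K_t \<otimes>\<^bsub>K\<^esub> ?B k = ?A k \<otimes>\<^bsub>K\<^esub> K_t"
    and U: "K_u \<otimes>\<^bsub>K\<^esub> ?A k = ?A k \<otimes>\<^bsub>K\<^esub> K_u" "K_u \<otimes>\<^bsub>K\<^esub> ?B k = ?B k \<otimes>\<^bsub>K\<^esub> K_u" for k
    by (simp_all add: K.int_pow_conj K_commutation)
  show ?thesis
  proof (cases x)
    case gA
    have "?A ?s \<otimes>\<^bsub>K\<^esub> (?A m \<otimes>\<^bsub>K\<^esub> (?B n \<otimes>\<^bsub>K\<^esub> ?Y)) = ?A (?s + m) \<otimes>\<^bsub>K\<^esub> (?B n \<otimes>\<^bsub>K\<^esub> ?Y)"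
      using Y by (simp add: K.int_pow_mult K.m_assoc del: K.int_pow_1)
    then show ?thesis
      unfolding l gA K_letter h word_val_nf by (simp add: word_val_nf d1 swaps_def)
  next
    case gB
    have "?B ?s \<otimes>\<^bsub>K\<^esub> (?A m \<otimes>\<^bsub>K\<^esub> (?B n \<otimes>\<^bsub>K\<^esub> ?Y)) = (?B ?s \<otimes>\<^bsub>K\<^esub> ?A m) \<otimes>\<^bsub>K\<^esub> (?B n \<otimes>\<^bsub>K\<^esub> ?Y)"
      using Y by (simp add: K.m_assoc del: K.int_pow_1)
    also have "\<dots> = ?A m \<otimes>\<^bsub>K\<^esub> (?B (?s + n) \<otimes>\<^bsub>K\<^esub> ?Y)"
      unfolding AB using Y by (simp add: K.int_pow_mult K.m_assoc del: K.int_pow_1)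
    finally show ?thesis
      unfolding l gB K_letter h word_val_nf by (simp add: word_val_nf d1 swaps_def)
  next
    case gT
    have "K_t \<otimes>\<^bsub>K\<^esub> (?A m \<otimes>\<^bsub>K\<^esub> (?B n \<otimes>\<^bsub>K\<^esub> ?Y)) = (K_t \<otimes>\<^bsub>K\<^esub> ?A m) \<otimes>\<^bsub>K\<^esub> (?B n \<otimes>\<^bsub>K\<^esub> ?Y)"
      using Y by (simp add: K.m_assoc)
    also have "\<dots> = ?B m \<otimes>\<^bsub>K\<^esub> ((K_t \<otimes>\<^bsub>K\<^esub> ?B n) \<otimes>\<^bsub>K\<^esub> ?Y)"
      unfolding T(1) using Y by (simp add: K.m_assoc)
    also have "\<dots> = (?B m \<otimes>\<^bsub>K\<^esub> ?A n) \<otimes>\<^bsub>K\<^esub> (K_t \<otimes>\<^bsub>K\<^esub> ?Y)"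
      unfolding T(2) using Y by (simp add: K.m_assoc)
    also have "\<dots> = ?A n \<otimes>\<^bsub>K\<^esub> (?B m \<otimes>\<^bsub>K\<^esub> (K_t \<otimes>\<^bsub>K\<^esub> ?Y))"
      unfolding AB using Y by (simp add: K.m_assoc)
    finally show ?thesis
      unfolding l gT K_letter h word_val_nf by (simp add: word_val_nf tu_word_mult[OF d] swaps_def)
  next
    case gU
    have "K_u \<otimes>\<^bsub>K\<^esub> (?A m \<otimes>\<^bsub>K\<^esub> (?B n \<otimes>\<^bsub>K\<^esub> ?Y)) = (K_u \<otimes>\<^bsub>K\<^esub> ?A m) \<otimes>\<^bsub>K\<^esub> (?B n \<otimes>\<^bsub>K\<^esub> ?Y)"
      using Y by (simp add: K.m_assoc)
    also have "\<dots> = ?A m \<otimes>\<^bsub>K\<^esub> ((K_u \<otimes>\<^bsub>K\<^esub> ?B n) \<otimes>\<^bsub>K\<^esub> ?Y)"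
      unfolding U(1) using Y by (simp add: K.m_assoc)
    also have "\<dots> = ?A m \<otimes>\<^bsub>K\<^esub> (?B n \<otimes>\<^bsub>K\<^esub> (K_u \<otimes>\<^bsub>K\<^esub> ?Y))"
      unfolding U(2) using Y by (simp add: K.m_assoc)
    finally show ?thesis
      unfolding l gU K_letter h word_val_nf by (simp add: word_val_nf tu_word_mult[OF d] swaps_def)
  qed
qed

text \<open>Multiplying letter by letter from the left brings any word into normal form. Words with
  equal value thus represent the same element, which is the converse of
  \<open>gword_val_cong\<close>.\<close>

lemma pres_class_eq_nf: "pres_class K_rels w = word_val K (nf (gword_val w))"
proof (induction w)
  case Nil
  then show ?case by (simp add: gword_val_Nil one_K nf_def power_word_def tu_word_def)
next
  case (Cons l w)
  have "pres_class K_rels (l # w) = pres_class K_rels [l] \<otimes>\<^bsub>K\<^esub> pres_class K_rels w"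
    by (simp add: mult_K)
  then show ?case
    using Cons letter_mult_nf[OF gword_val_carrier] by (simp add: gword_val_Cons)
qed

text \<open>Evaluation is constant on each class, so the image of a class is a singleton and
  evaluation descends to \<open>K\<close>.\<close>

definition coord :: "K_elt \<Rightarrow> (int \<times> int) \<times> (int \<times> bool)" where
  "coord X = the_elem (gword_val ` X)"

lemma coord_pres_class [simp]: "coord (pres_class K_rels w) = gword_val w"
proof -
  have "gword_val ` pres_class K_rels w = {gword_val w}"
    using gword_val_cong by (auto simp: pres_class_def intro: pres_eq.refl)
  then show ?thesis by (simp add: coord_def)
qed

lemma coord_mult:
  "x \<in> carrier K \<Longrightarrow> y \<in> carrier K \<Longrightarrow> coord (x \<otimes>\<^bsub>K\<^esub> y) = coord x \<otimes>\<^bsub>Z2D8\<^esub> coord y"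
  by (auto simp: carrier_K mult_K gword_val_append)

lemma coord_carrier: "x \<in> carrier K \<Longrightarrow> coord x \<in> carrier Z2D8"
  by (auto simp: carrier_K gword_val_carrier)

lemma word_val_nf_coord: "x \<in> carrier K \<Longrightarrow> word_val K (nf (coord x)) = x"
  by (auto simp: carrier_K simp flip: pres_class_eq_nf)

lemma inj_coord: "inj_on coord (carrier K)"
  by (rule inj_on_inverseI[of _ "\<lambda>h. word_val K (nf h)"]) (rule word_val_nf_coord)

lemma coord_letter:
  shows coord_one: "coord \<one>\<^bsub>K\<^esub> = ((0, 0), (0, False))"
    and coord_a: "coord K_a = ((1, 0), (0, False))" "coord (inv\<^bsub>K\<^esub> K_a) = ((- 1, 0), (0, False))"
    and coord_b: "coord K_b = ((0, 1), (0, False))" "coord (inv\<^bsub>K\<^esub> K_b) = ((0, - 1), (0, False))"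
    and coord_t: "coord K_t = ((0, 0), (0, True))"
    and coord_u: "coord K_u = ((0, 0), (3, True))"
  by (simp_all add: one_K K_a_def K_b_def K_t_def K_u_def inv_gen gword_val_Nil gword_val_Cons mult_D8
      swaps_def)

section \<open>Lengths\<close>

lemma word_val_lists: "w \<in> lists K_Z \<Longrightarrow> word_val K w \<in> carrier K"
  using K_Z_carrier by (intro K.word_val_closed) auto

lemma coord_word_val_Cons:
  "x \<in> K_Z \<Longrightarrow> w \<in> lists K_Z \<Longrightarrow>
     coord (word_val K (x # w)) = coord x \<otimes>\<^bsub>Z2D8\<^esub> coord (word_val K w)"
  using K_Z_carrier by (simp add: coord_mult subset_iff word_val_lists del: in_lists_conv_set)

lemma coord_word_val_snoc:
  assumes "x \<in> K_Z" "w \<in> lists K_Z"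
  shows "coord (word_val K (w @ [x])) = coord (word_val K w) \<otimes>\<^bsub>Z2D8\<^esub> coord x"
proof -
  have x: "x \<in> carrier K" and w: "set w \<subseteq> carrier K" using assms K_Z_carrier by auto
  then show ?thesis by (simp add: K.word_val_append coord_mult K.word_val_closed)
qed

lemma coord_word_val_replicate:
  assumes "w \<in> lists K_Z" "coord (word_val K w) = ((m, n), d)"
  shows "coord (word_val K (replicate k K_a @ w)) = ((m + int k, n), d)"
    "coord (word_val K (replicate k (inv\<^bsub>K\<^esub> K_a) @ w)) = ((m - int k, n), d)"
    "coord (word_val K (replicate k K_b @ w)) = ((m, n + int k), d)"
    "coord (word_val K (replicate k (inv\<^bsub>K\<^esub> K_b) @ w)) = ((m, n - int k), d)"
proof -
  have d: "d \<in> carrier (dihedral_group 4)"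
    using coord_carrier[OF word_val_lists[OF assms(1)]] assms(2) by (auto simp: carrier_Z2D8 carrier_D8)
  have one: "(0, False) \<otimes>\<^bsub>dihedral_group 4\<^esub> d = d"
    using D8.l_one[OF d] by (simp add: dihedral_group_def)
  have *: "replicate k x @ w \<in> lists K_Z" if "x \<in> K_Z" for x k using assms(1) that by auto
  have Z: "K_a \<in> K_Z" "inv\<^bsub>K\<^esub> K_a \<in> K_Z" "K_b \<in> K_Z" "inv\<^bsub>K\<^esub> K_b \<in> K_Z" by (auto simp: K_Z_def)
  show "coord (word_val K (replicate k K_a @ w)) = ((m + int k, n), d)"
    "coord (word_val K (replicate k (inv\<^bsub>K\<^esub> K_a) @ w)) = ((m - int k, n), d)"
    "coord (word_val K (replicate k K_b @ w)) = ((m, n + int k), d)"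
    "coord (word_val K (replicate k (inv\<^bsub>K\<^esub> K_b) @ w)) = ((m, n - int k), d)"
    by (induction k) (simp_all only: replicate_Suc replicate_0 append_Cons append_Nil
        coord_word_val_Cons * Z, simp_all add: assms(2) coord_letter swaps_def one)
qed

lemma coord_tu_word:
  assumes "d \<in> carrier (dihedral_group 4)"
  shows "coord (word_val K (tu_word d)) = ((0, 0), d)"
  using assms
  by (auto simp: carrier_D8 rots_def tu_word_def coord_mult coord_letter swaps_def mult_D8)

lemma coord_nf:
  assumes "h \<in> carrier Z2D8"
  shows "coord (word_val K (nf h)) = h"
proof -
  obtain m n d where h: "h = ((m, n), d)" and d: "d \<in> carrier (dihedral_group 4)"
    using assms by (cases h) (auto simp: carrier_Z2D8 carrier_D8)
  have "coord (word_val K (power_word K_b n @ tu_word d)) = ((0, n), d)"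
    unfolding power_word_def
    using coord_word_val_replicate[OF tu_word_lists coord_tu_word[OF d]] by simp
  moreover have "power_word K_b n @ tu_word d \<in> lists K_Z"
    unfolding append_in_lists_conv using tu_word_lists power_word_lists by blast
  ultimately show ?thesis
    unfolding h nf_def prod.case power_word_def[of K_a]
    using coord_word_val_replicate by simp
qed

text \<open>An element is recovered from the normal form of its coordinates, and every
  \<open>h\<close> is the coordinate of the word \<open>nf h\<close>.\<close>

lemma coord_iso: "coord \<in> iso K Z2D8"
proof (rule isoI)
  show "coord \<in> hom K Z2D8" by (rule homI) (simp_all add: coord_carrier coord_mult)
  have "h \<in> coord ` carrier K" if "h \<in> carrier Z2D8" for h
    using coord_nf[OF that] word_val_lists[OF nf_lists] by (metis imageI)
  then show "bij_betw coord (carrier K) (carrier Z2D8)"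
    using inj_coord coord_carrier by (auto simp: bij_betw_def)
qed

section \<open>Word length and conjugacy length in coordinates\<close>

lemma length_power_word [simp]: "int (length (power_word x m)) = \<bar>m\<bar>"
  by (simp add: power_word_def)

lemma length_nf: "int (length (nf ((m, n), d))) = \<bar>m\<bar> + \<bar>n\<bar> + int (length (tu_word d))"
  by (simp add: nf_def)

lemma K_Z_cases:
  assumes "x \<in> K_Z"
  obtains "x = K_a" | "x = inv\<^bsub>K\<^esub> K_a" | "x = K_b" | "x = inv\<^bsub>K\<^esub> K_b" | "x = K_t" | "x = K_u"
  using assms by (auto simp: K_Z_def)

lemma Z2D8_cases:
  assumes "h \<in> carrier Z2D8"
  obtains m n d where "h = ((m, n), d)" "d \<in> carrier (dihedral_group 4)"
  using assms by (cases h) (auto simp: carrier_Z2D8 carrier_D8)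

lemma D8_one: "d \<in> carrier (dihedral_group 4) \<Longrightarrow> (0, False) \<otimes>\<^bsub>dihedral_group 4\<^esub> d = d"
   "d \<in> carrier (dihedral_group 4) \<Longrightarrow> d \<otimes>\<^bsub>dihedral_group 4\<^esub> (0, False) = d"
  using D8.l_one[of d] D8.r_one[of d] by (simp_all add: dihedral_group_def)

lemma length_tu_word_le:
  assumes "d \<in> carrier (dihedral_group 4)" "e \<in> {(0, True), (3, True)}"
  shows "length (tu_word (e \<otimes>\<^bsub>dihedral_group 4\<^esub> d)) \<le> Suc (length (tu_word d))"
    "length (tu_word (d \<otimes>\<^bsub>dihedral_group 4\<^esub> e)) \<le> Suc (length (tu_word d))"
  using assms by (auto simp: carrier_D8 rots_def tu_word_def mult_D8)

text \<open>A letter \<open>a\<close> or \<open>b\<close> or an inverse moves one coordinate by 1,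
  while \<open>t\<close> and \<open>u\<close> at most permute the coordinates and lengthen the
  dihedral part by at most 1. Left multiplication serves inductions over words, right multiplication
  the automaton that appends letters.\<close>

lemma length_nf_le:
  assumes x: "x \<in> K_Z" and h: "h \<in> carrier Z2D8"
  shows "length (nf (coord x \<otimes>\<^bsub>Z2D8\<^esub> h)) \<le> Suc (length (nf h))"
    and "length (nf (h \<otimes>\<^bsub>Z2D8\<^esub> coord x)) \<le> Suc (length (nf h))"
proof -
  obtain m n d where h: "h = ((m, n), d)" and d: "d \<in> carrier (dihedral_group 4)"
    using h by (rule Z2D8_cases)
  have "int (length (nf (coord x \<otimes>\<^bsub>Z2D8\<^esub> h))) \<le> int (Suc (length (nf h)))"
    using x by (rule K_Z_cases)
      (use length_tu_word_le(1)[OF d, of "(0, True)"] length_tu_word_le(1)[OF d, of "(3, True)"] in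
        \<open>simp_all add: h coord_letter length_nf swaps_def D8_one[OF d]\<close>)
  then show "length (nf (coord x \<otimes>\<^bsub>Z2D8\<^esub> h)) \<le> Suc (length (nf h))" by linarith
  have "int (length (nf (h \<otimes>\<^bsub>Z2D8\<^esub> coord x))) \<le> int (Suc (length (nf h)))"
    using x by (rule K_Z_cases)
      (use length_tu_word_le(2)[OF d, of "(0, True)"] length_tu_word_le(2)[OF d, of "(3, True)"] in
        \<open>(cases "swaps d"; simp add: h coord_letter length_nf D8_one[OF d])+\<close>)
  then show "length (nf (h \<otimes>\<^bsub>Z2D8\<^esub> coord x)) \<le> Suc (length (nf h))" by linarith
qed

lemma length_nf_coord_le: "w \<in> lists K_Z \<Longrightarrow> length (nf (coord (word_val K w))) \<le> length w"
proof (induction w)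
  case Nil
  then show ?case by (simp add: coord_one nf_def power_word_def tu_word_def)
next
  case (Cons x w)
  then have x: "x \<in> K_Z" and w: "w \<in> lists K_Z" by auto
  show ?case
    using length_nf_le(1)[OF x coord_carrier[OF word_val_lists[OF w]]] Cons.IH[OF w]
    by (simp add: coord_word_val_Cons[OF x w] del: K.word_val_simps)
qed

text \<open>The normal form represents \<open>g\<close>, and by \<open>length_nf_coord_le\<close> no
  word for \<open>g\<close> is shorter.\<close>

lemma elt_length_K: "g \<in> carrier K \<Longrightarrow> elt_length K K_Z g = length (nf (coord g))"
  unfolding elt_length_def
  by (rule Least_equality)
    (use nf_lists word_val_nf_coord length_nf_coord_le in \<open>blast, blast\<close>)

text \<open>The minimal length in a conjugacy class of the dihedral group: \<open>t u t\<close> and \<open>u t u\<close> are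
  the only elements that are longer than some conjugate.\<close>

definition tu_clen :: "int \<times> bool \<Rightarrow> nat" where
  "tu_clen d = (if d \<in> {(1, True), (2, True)} then 1 else length (tu_word d))"

text \<open>If the dihedral part swaps the coordinates, conjugation by \<open>\<int>\<^sup>2\<close> can move everything into the
  first coordinate, so only the sum of the coordinates counts.\<close>

definition clen :: "(int \<times> int) \<times> (int \<times> bool) \<Rightarrow> nat" where
  "clen = (\<lambda>((m, n), d). (if swaps d then nat \<bar>m + n\<bar> else nat \<bar>m\<bar> + nat \<bar>n\<bar>) + tu_clen d)"

lemma tu_clen_commute:
  assumes "d \<in> carrier (dihedral_group 4)" "d' \<in> carrier (dihedral_group 4)"
  shows "tu_clen (d \<otimes>\<^bsub>dihedral_group 4\<^esub> d') = tu_clen (d' \<otimes>\<^bsub>dihedral_group 4\<^esub> d)"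
proof -
  obtain i e j f where "d = (i, e)" "d' = (j, f)" by force
  then show ?thesis
    using assms
    by (cases e; cases f) (auto simp: carrier_D8 rots_def tu_clen_def tu_word_def mult_D8)
qed

text \<open>Symmetry in the two factors is invariance under conjugation, without mentioning
  inverses. If the product swaps, only the total sum of coordinates enters; otherwise the two
  products have the same coordinates up to order.\<close>

lemma clen_commute:
  assumes "g \<in> carrier Z2D8" "h \<in> carrier Z2D8"
  shows "clen (g \<otimes>\<^bsub>Z2D8\<^esub> h) = clen (h \<otimes>\<^bsub>Z2D8\<^esub> g)"
proof -
  obtain m n d where g: "g = ((m, n), d)" and d: "d \<in> carrier (dihedral_group 4)"
    using assms(1) by (rule Z2D8_cases)
  obtain m' n' d' where h: "h = ((m', n'), d')" and d': "d' \<in> carrier (dihedral_group 4)"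
    using assms(2) by (rule Z2D8_cases)
  show ?thesis
    by (cases "swaps d"; cases "swaps d'")
      (simp_all add: g h clen_def tu_clen_commute[OF d d'] algebra_simps)
qed

lemma clen_le_length_nf:
  assumes "h \<in> carrier Z2D8" shows "clen h \<le> length (nf h)"
proof -
  obtain m n d where h: "h = ((m, n), d)" and d: "d \<in> carrier (dihedral_group 4)"
    using assms by (rule Z2D8_cases)
  have "tu_clen d \<le> length (tu_word d)" by (auto simp: tu_clen_def tu_word_def)
  moreover have "nat \<bar>m + n\<bar> \<le> nat \<bar>m\<bar> + nat \<bar>n\<bar>" by linarith
  moreover have "length (nf h) = nat \<bar>m\<bar> + nat \<bar>n\<bar> + length (tu_word d)"
    using length_nf[of m n d] by (simp add: h)
  ultimately show ?thesis by (simp add: h clen_def)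
qed

text \<open>The equation expresses that \<open>k\<close> is the conjugate of \<open>g\<close> by
  \<open>h\<close>.\<close>

lemma clen_attained:
  assumes "g \<in> carrier Z2D8"
  shows "\<exists>h\<in>carrier Z2D8. \<exists>k\<in>carrier Z2D8.
    g \<otimes>\<^bsub>Z2D8\<^esub> h = h \<otimes>\<^bsub>Z2D8\<^esub> k \<and> length (nf k) = clen g"
proof -
  obtain m n d where g: "g = ((m, n), d)" and d: "d \<in> carrier (dihedral_group 4)"
    using assms by (rule Z2D8_cases)
  have len: "length (nf ((m, n), d)) = nat \<bar>m\<bar> + nat \<bar>n\<bar> + length (tu_word d)" for m n d
    using length_nf[of m n d] by linarith
  obtain h k where "h \<in> carrier Z2D8" "k \<in> carrier Z2D8"
    "g \<otimes>\<^bsub>Z2D8\<^esub> h = h \<otimes>\<^bsub>Z2D8\<^esub> k" "length (nf k) = clen g"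
  proof (cases "swaps d")
    case False
    show thesis
    proof (cases "d = (1, True)")
      case True
      \<comment> \<open>Conjugation by \<open>t\<close> turns \<open>t u t\<close> into
        \<open>u\<close> and exchanges the coordinates.\<close>
      show thesis
        by (rule that[of "((0, 0), (0, True))" "((n, m), (3, True))"])
          (auto simp: g True len carrier_Z2D8 rots_def clen_def tu_clen_def tu_word_def swaps_def mult_D8)
    next
      case False
      have "d \<noteq> (2, True)" using \<open>\<not> swaps d\<close> by (auto simp: swaps_def)
      then have "length (nf g) = clen g"
        using \<open>\<not> swaps d\<close> False by (simp add: g len clen_def tu_clen_def)
      then show thesis using assms H.l_one H.r_one
        by (intro that[of "\<one>\<^bsub>Z2D8\<^esub>" g]) (simp_all del: one_Z2D8)
    qed
  next
    case True
    show thesis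
    proof (cases "d = (2, True)")
      case True
      \<comment> \<open>Conjugation by \<open>u\<close> turns \<open>u t u\<close> into
        \<open>t\<close>; the extra factor in the first coordinate gathers everything there.\<close>
      show thesis
        by (rule that[of "((- n, 0), (3, True))" "((m + n, 0), (0, True))"])
          (auto simp: g True len carrier_Z2D8 rots_def clen_def tu_clen_def tu_word_def swaps_def mult_D8)
    next
      case False
      \<comment> \<open>The dihedral part is already shortest in its class, so conjugating by a
        power of \<open>a\<close> that clears the second coordinate is enough.\<close>
      then show thesis using \<open>swaps d\<close> d
        by (intro that[of "((- n, 0), (0, False))" "((m + n, 0), d)"])
          (auto simp: g len carrier_Z2D8 carrier_D8 rots_def clen_def tu_clen_def tu_word_def
            swaps_def mult_D8)
    qed
  qed
  then show ?thesis by blast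
qed

lemma conj_length_K:
  assumes g: "g \<in> carrier K"
  shows "conj_length K K_Z g = clen (coord g)"
  unfolding conj_length_def
proof (rule Least_equality)
  obtain h k where hk: "h \<in> carrier Z2D8" "k \<in> carrier Z2D8"
    "coord g \<otimes>\<^bsub>Z2D8\<^esub> h = h \<otimes>\<^bsub>Z2D8\<^esub> k" "length (nf k) = clen (coord g)"
    using clen_attained[OF coord_carrier[OF g]] by blast
  let ?h = "word_val K (nf h)" and ?k = "word_val K (nf k)"
  have c: "?h \<in> carrier K" "?k \<in> carrier K" by (simp_all add: word_val_lists nf_lists)
  have "coord (g \<otimes>\<^bsub>K\<^esub> ?h) = coord (?h \<otimes>\<^bsub>K\<^esub> ?k)"
    using hk c g by (simp add: coord_mult coord_nf)
  then have "g \<otimes>\<^bsub>K\<^esub> ?h = ?h \<otimes>\<^bsub>K\<^esub> ?k"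
    using inj_coord c g by (simp add: inj_on_eq_iff)
  then have "?k = inv\<^bsub>K\<^esub> ?h \<otimes>\<^bsub>K\<^esub> g \<otimes>\<^bsub>K\<^esub> ?h"
    using c g K.inv_solve_left[of ?k ?h "g \<otimes>\<^bsub>K\<^esub> ?h"] by (simp add: K.m_assoc)
  then have "?k \<in> conj_class K g" using c unfolding conj_class_def by blast
  moreover have "clen (coord g) = elt_length K K_Z ?k"
    using c hk by (simp add: elt_length_K coord_nf)
  ultimately show "\<exists>h\<in>conj_class K g. clen (coord g) = elt_length K K_Z h" by blast
next
  fix y assume "\<exists>h\<in>conj_class K g. y = elt_length K K_Z h"
  then obtain h where h: "h \<in> carrier K" "y = elt_length K K_Z (inv\<^bsub>K\<^esub> h \<otimes>\<^bsub>K\<^esub> g \<otimes>\<^bsub>K\<^esub> h)"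
    by (auto simp: conj_class_def)
  \<comment> \<open>Commuting the last factor \<open>h\<close> to the front cancels the
    conjugation.\<close>
  have "clen (coord (inv\<^bsub>K\<^esub> h \<otimes>\<^bsub>K\<^esub> g \<otimes>\<^bsub>K\<^esub> h)) = clen (coord (h \<otimes>\<^bsub>K\<^esub> (inv\<^bsub>K\<^esub> h \<otimes>\<^bsub>K\<^esub> g)))"
    using h g by (simp add: coord_mult clen_commute coord_carrier)
  also have "h \<otimes>\<^bsub>K\<^esub> (inv\<^bsub>K\<^esub> h \<otimes>\<^bsub>K\<^esub> g) = g"
    using h(1) g by (simp flip: K.m_assoc)
  finally show "clen (coord g) \<le> y"
    using h g clen_le_length_nf[OF coord_carrier[of "inv\<^bsub>K\<^esub> h \<otimes>\<^bsub>K\<^esub> g \<otimes>\<^bsub>K\<^esub> h"]] by (simp add: elt_length_K)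
qed

section \<open>The languages\<close>

text \<open>Whether appending a letter to a geodesic yields a geodesic depends only on the signs of the
  coordinates and on the dihedral part; these are the states of the automaton.\<close>

definition sign_part :: "(int \<times> int) \<times> (int \<times> bool) \<Rightarrow> (int \<times> int) \<times> (int \<times> bool)" where
  "sign_part = (\<lambda>((m, n), d). ((sgn m, sgn n), d))"

text \<open>A letter \<open>a\<close> or \<open>b\<close> or an inverse adds length exactly when it
  moves its coordinate away from 0, which the sign decides; for \<open>t\<close> and
  \<open>u\<close> the dihedral part decides. The new sign is predicted only for such steps: going
  from 2 to 1 keeps the sign, going from 1 to 0 does not.\<close>

lemma length_nf_step:
  assumes x: "x \<in> K_Z" and h: "h \<in> carrier Z2D8"
  shows "length (nf (h \<otimes>\<^bsub>Z2D8\<^esub> coord x)) = Suc (length (nf h)) \<longleftrightarrow>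
      length (nf (sign_part h \<otimes>\<^bsub>Z2D8\<^esub> coord x)) = Suc (length (nf (sign_part h)))" (is "?L \<longleftrightarrow> ?R")
    and "length (nf (h \<otimes>\<^bsub>Z2D8\<^esub> coord x)) = Suc (length (nf h)) \<Longrightarrow>
      sign_part (h \<otimes>\<^bsub>Z2D8\<^esub> coord x) = sign_part (sign_part h \<otimes>\<^bsub>Z2D8\<^esub> coord x)"
proof -
  obtain m n d where h: "h = ((m, n), d)" and d: "d \<in> carrier (dihedral_group 4)"
    using h by (rule Z2D8_cases)
  have eq: "?L \<longleftrightarrow> int (length (nf (h \<otimes>\<^bsub>Z2D8\<^esub> coord x))) = int (length (nf h)) + 1"
    "?R \<longleftrightarrow> int (length (nf (sign_part h \<otimes>\<^bsub>Z2D8\<^esub> coord x))) = int (length (nf (sign_part h))) + 1"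
    by linarith+
  have "(?L \<longleftrightarrow> ?R) \<and> (?L \<longrightarrow> sign_part (h \<otimes>\<^bsub>Z2D8\<^esub> coord x) = sign_part (sign_part h \<otimes>\<^bsub>Z2D8\<^esub> coord x))"
    using x unfolding eq
    by (rule K_Z_cases)
      (cases "swaps d"; auto simp: h sign_part_def coord_letter length_nf D8_one[OF d] sgn_if)+
  then show "?L \<longleftrightarrow> ?R" "?L \<Longrightarrow> sign_part (h \<otimes>\<^bsub>Z2D8\<^esub> coord x) = sign_part (sign_part h \<otimes>\<^bsub>Z2D8\<^esub> coord x)"
    by blast+
qed

lemma sign_part_range: "h \<in> carrier Z2D8 \<Longrightarrow> sign_part h \<in> ({- 1, 0, 1} \<times> {- 1, 0, 1}) \<times> carrier (dihedral_group 4)"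
  by (erule Z2D8_cases) (auto simp: sign_part_def sgn_if)

text \<open>Both contributions to \<open>clen\<close> are at most those to the length, so equality
  must hold in each. For the coordinates under a swap it means that the signs are not
  opposite.\<close>

lemma clen_sign_part:
  assumes "h \<in> carrier Z2D8"
  shows "length (nf (sign_part h)) = clen (sign_part h) \<longleftrightarrow> length (nf h) = clen h"
proof -
  obtain m n d where h: "h = ((m, n), d)" and d: "d \<in> carrier (dihedral_group 4)"
    using assms by (rule Z2D8_cases)
  have len: "length (nf ((m, n), d)) = nat \<bar>m\<bar> + nat \<bar>n\<bar> + length (tu_word d)" for m n d
    using length_nf[of m n d] by linarith
  have le: "tu_clen d \<le> length (tu_word d)" by (auto simp: tu_clen_def tu_word_def)
  show ?thesis
    using le by (cases "swaps d") (auto simp: h sign_part_def len clen_def sgn_if)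
qed

text \<open>The state is the sign part as long as the word is geodesic, and afterwards the sink
  \<open>None\<close>, since prefixes of geodesics are geodesic. The predicate \<open>P\<close>
  selects the accepting signs.\<close>

lemma regular_geodesic:
  "regular_language K_Z {w \<in> lists K_Z. length w = length (nf (coord (word_val K w))) \<and>
     P (sign_part (coord (word_val K w)))}"
proof (rule regular_languageI)
  let ?c = "\<lambda>w. coord (word_val K w)"
  let ?f = "\<lambda>w. if length w = length (nf (?c w)) then Some (sign_part (?c w)) else None"
  let ?\<delta> = "\<lambda>s x. case s of None \<Rightarrow> None
    | Some s \<Rightarrow> if length (nf (s \<otimes>\<^bsub>Z2D8\<^esub> coord x)) = Suc (length (nf s))
        then Some (sign_part (s \<otimes>\<^bsub>Z2D8\<^esub> coord x)) else None"
  let ?S = "({- 1, 0, 1} \<times> {- 1, 0, 1}) \<times> carrier (dihedral_group 4)"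
  have c: "?c w \<in> carrier Z2D8" if "w \<in> lists K_Z" for w
    using that by (intro coord_carrier word_val_lists)
  have "?f w \<in> insert None (Some ` ?S)" if "w \<in> lists K_Z" for w
    using sign_part_range[OF c[OF that]] by simp
  then have "?f ` lists K_Z \<subseteq> insert None (Some ` ?S)" by (rule image_subsetI)
  then show "finite (?f ` lists K_Z)"
    by (rule finite_subset) (simp add: carrier_D8 rots_def)
  show "w \<in> {w \<in> lists K_Z. length w = length (nf (?c w)) \<and> P (sign_part (?c w))} \<longleftrightarrow>
      (case ?f w of None \<Rightarrow> False | Some s \<Rightarrow> P s)" if "w \<in> lists K_Z" for w
    using that by simp
  show "?f (w @ [x]) = ?\<delta> (?f w) x" if w: "w \<in> lists K_Z" and x: "x \<in> K_Z" for w x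
    using length_nf_step[OF x c[OF w]] length_nf_le(2)[OF x c[OF w]] length_nf_coord_le[OF w]
    by (auto simp: coord_word_val_snoc[OF x w])
qed blast

section \<open>Regularity of the geodesic languages and of the set of normal forms\<close>

lemma Geo_K: "Geo K K_Z = {w \<in> lists K_Z. length w = length (nf (coord (word_val K w)))}"
  unfolding Geo_def by (rule Collect_cong) (metis elt_length_K word_val_lists)

lemma ConjGeo_K: "ConjGeo K K_Z = {w \<in> lists K_Z. length w = clen (coord (word_val K w))}"
  unfolding ConjGeo_def by (rule Collect_cong) (metis conj_length_K word_val_lists)

lemma regular_Geo: "regular_language K_Z (Geo K K_Z)"
  using regular_geodesic[of "\<lambda>_. True"] by (simp add: Geo_K del: in_lists_conv_set)

lemma regular_ConjGeo: "regular_language K_Z (ConjGeo K K_Z)"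
proof -
  \<comment> \<open>Since \<open>clen\<close> is at most the geodesic length and that is at most
    \<open>length w\<close>, a word of length \<open>clen\<close> is geodesic.\<close>
  have "length w = clen (coord (word_val K w)) \<longleftrightarrow>
      length w = length (nf (coord (word_val K w))) \<and>
      length (nf (sign_part (coord (word_val K w)))) = clen (sign_part (coord (word_val K w)))"
    if "w \<in> lists K_Z" for w
  proof -
    have c: "coord (word_val K w) \<in> carrier Z2D8"
      using that by (intro coord_carrier word_val_lists)
    show ?thesis
      using clen_sign_part[OF c] clen_le_length_nf[OF c] length_nf_coord_le[OF that] by auto
  qed
  then have "ConjGeo K K_Z = {w \<in> lists K_Z. length w = length (nf (coord (word_val K w))) \<and>
     length (nf (sign_part (coord (word_val K w)))) = clen (sign_part (coord (word_val K w)))}"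
    unfolding ConjGeo_K by blast
  then show ?thesis using regular_geodesic[of "\<lambda>s. length (nf s) = clen s"] by simp
qed

text \<open>The set is a concatenation of powers of \<open>a\<close> or its inverse, powers of
  \<open>b\<close> or its inverse, and eight fixed words.\<close>

lemma regular_nf: "regular_language K_Z (nf ` carrier Z2D8)"
proof -
  define pows where "pows x = range (\<lambda>n. replicate n x) \<union> range (\<lambda>n. replicate n (inv\<^bsub>K\<^esub> x))" for x
  let ?Y = "tu_word ` carrier (dihedral_group 4)"
  have pows: "pows x = range (power_word x)" for x
  proof (intro equalityI subsetI)
    fix w assume "w \<in> pows x"
    then obtain n where "w = replicate n x \<or> w = replicate n (inv\<^bsub>K\<^esub> x)" by (auto simp: pows_def)
    then have "w = power_word x (int n) \<or> w = power_word x (- int n)"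
      by (auto simp: power_word_def)
    then show "w \<in> range (power_word x)" by blast
  qed (auto simp: pows_def power_word_def)
  have reg: "regular_language K_Z (pows K_a)" "regular_language K_Z (pows K_b)"
    unfolding pows_def by (intro regular_language_Un regular_language_powers; simp add: K_Z_def)+
  have "regular_language K_Z ?Y"
    using tu_word_lists by (intro regular_language_finite) (auto simp: carrier_D8 rots_def)
  note regular_language_conc[OF reg(1) regular_language_conc[OF reg(2) this]]
  moreover have "{v @ w |v w. v \<in> pows K_a \<and> w \<in> {v @ w |v w. v \<in> pows K_b \<and> w \<in> ?Y}}
      = nf ` carrier Z2D8"
  proof (intro equalityI subsetI)
    fix z assume "z \<in> {v @ w |v w. v \<in> pows K_a \<and> w \<in> {v @ w |v w. v \<in> pows K_b \<and> w \<in> ?Y}}"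
    then obtain m n d where "z = nf ((m, n), d)" "d \<in> carrier (dihedral_group 4)"
      by (auto simp: pows nf_def)
    then show "z \<in> nf ` carrier Z2D8" by (auto simp: carrier_Z2D8 carrier_D8)
  next
    fix z assume "z \<in> nf ` carrier Z2D8"
    then obtain m n d where "z = nf ((m, n), d)" and d: "d \<in> carrier (dihedral_group 4)"
      by (auto simp: carrier_Z2D8 carrier_D8)
    then have "z = power_word K_a m @ power_word K_b n @ tu_word d" by (simp add: nf_def)
    moreover have "power_word K_a m \<in> pows K_a" "power_word K_b n \<in> pows K_b"
      by (simp_all add: pows)
    ultimately show "z \<in> {v @ w |v w. v \<in> pows K_a \<and> w \<in> {v @ w |v w. v \<in> pows K_b \<and> w \<in> ?Y}}"
      using d by blast
  qed
  ultimately show ?thesis by simp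
qed

section \<open>Normal forms are shortlex least\<close>

lemma power_word_pos: "0 < m \<Longrightarrow> power_word x m = x # power_word x (m - 1)"
  and power_word_neg: "m < 0 \<Longrightarrow> power_word x m = inv\<^bsub>K\<^esub> x # power_word x (m + 1)"
proof -
  assume m: "0 < m"
  then have "nat m = Suc (nat (m - 1))" by simp
  then show "power_word x m = x # power_word x (m - 1)" using m by (simp add: power_word_def)
next
  assume m: "m < 0"
  then have "nat (- m) = Suc (nat (- (m + 1)))" by simp
  then show "power_word x m = inv\<^bsub>K\<^esub> x # power_word x (m + 1)"
    using m by (auto simp: power_word_def)
qed

lemma power_word_0: "power_word x 0 = []"
  by (simp add: power_word_def)

lemma nf_Cons:
  shows "0 < m \<Longrightarrow> nf ((m, n), d) = K_a # nf ((m - 1, n), d)"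
    and "m < 0 \<Longrightarrow> nf ((m, n), d) = inv\<^bsub>K\<^esub> K_a # nf ((m + 1, n), d)"
    and "0 < n \<Longrightarrow> nf ((0, n), d) = K_b # nf ((0, n - 1), d)"
    and "n < 0 \<Longrightarrow> nf ((0, n), d) = inv\<^bsub>K\<^esub> K_b # nf ((0, n + 1), d)"
  by (simp_all add: nf_def power_word_0 power_word_pos power_word_neg)

lemma tu_word_t:
  assumes "d \<in> carrier (dihedral_group 4)"
    and "length (tu_word ((0, True) \<otimes>\<^bsub>dihedral_group 4\<^esub> d)) = Suc (length (tu_word d))"
  shows "tu_word ((0, True) \<otimes>\<^bsub>dihedral_group 4\<^esub> d) = K_t # tu_word d"
  using assms by (auto simp: carrier_D8 rots_def tu_word_def mult_D8 split: if_splits)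

text \<open>The second alternative is for \<open>t u t\<close>: prepending \<open>u\<close> gives
  \<open>u t u t\<close>, whose normal form \<open>t u t u\<close> starts with
  \<open>t\<close>.\<close>

lemma tu_word_u:
  assumes "d \<in> carrier (dihedral_group 4)"
    and "length (tu_word ((3, True) \<otimes>\<^bsub>dihedral_group 4\<^esub> d)) = Suc (length (tu_word d))"
  shows "tu_word ((3, True) \<otimes>\<^bsub>dihedral_group 4\<^esub> d) = K_u # tu_word d \<or>
    (\<exists>w. tu_word ((3, True) \<otimes>\<^bsub>dihedral_group 4\<^esub> d) = K_t # w)"
  using assms by (auto simp: carrier_D8 rots_def tu_word_def mult_D8 split: if_splits)

lemma nf_replicate:
  "nf ((int i, int j), (0, False)) = replicate i K_a @ replicate j K_b"
  by (simp add: nf_def power_word_def tu_word_def)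

text \<open>Either order of a generator and its inverse is allowed; a normal form never contains
  both.\<close>

locale K_order =
  fixes r :: "K_elt rel"
  assumes order: "strict_linear_order_on K_Z r"
    and ab: "{K_a, inv\<^bsub>K\<^esub> K_a} \<times> {K_b, inv\<^bsub>K\<^esub> K_b} \<subseteq> r"
    and bt: "{K_b, inv\<^bsub>K\<^esub> K_b} \<times> {K_t} \<subseteq> r"
    and tu: "(K_t, K_u) \<in> r"
begin

lemma trans: "trans r" and irrefl: "irrefl r"
  using order by (auto simp: strict_linear_order_on_def)

lemma letter_less:
  shows "x \<in> {K_a, inv\<^bsub>K\<^esub> K_a} \<Longrightarrow> y \<in> {K_b, inv\<^bsub>K\<^esub> K_b} \<Longrightarrow> (x, y) \<in> r"
    and "x \<in> {K_a, inv\<^bsub>K\<^esub> K_a} \<Longrightarrow> (x, K_t) \<in> r" and "x \<in> {K_a, inv\<^bsub>K\<^esub> K_a} \<Longrightarrow> (x, K_u) \<in> r"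
    and "y \<in> {K_b, inv\<^bsub>K\<^esub> K_b} \<Longrightarrow> (y, K_t) \<in> r" and "y \<in> {K_b, inv\<^bsub>K\<^esub> K_b} \<Longrightarrow> (y, K_u) \<in> r"
proof -
  show xy: "x \<in> {K_a, inv\<^bsub>K\<^esub> K_a} \<Longrightarrow> y \<in> {K_b, inv\<^bsub>K\<^esub> K_b} \<Longrightarrow> (x, y) \<in> r" for x y
    using ab by blast
  show yt: "y \<in> {K_b, inv\<^bsub>K\<^esub> K_b} \<Longrightarrow> (y, K_t) \<in> r" for y using bt by blast
  then show "y \<in> {K_b, inv\<^bsub>K\<^esub> K_b} \<Longrightarrow> (y, K_u) \<in> r" using tu trans by (meson transD)
  show xt: "x \<in> {K_a, inv\<^bsub>K\<^esub> K_a} \<Longrightarrow> (x, K_t) \<in> r" for x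
    using xy[of x K_b] yt[of K_b] trans by (auto dest: transD)
  show "x \<in> {K_a, inv\<^bsub>K\<^esub> K_a} \<Longrightarrow> (x, K_u) \<in> r" using xt tu trans by (meson transD)
qed

text \<open>The two words have equal length, so unless they agree it suffices that the normal form
  begins with a smaller letter than \<open>x\<close>. Its first letter comes from the first nonzero
  coordinate, or else from the dihedral part.\<close>

lemma lenlex_nf_Cons:
  assumes x: "x \<in> K_Z" and h: "h \<in> carrier Z2D8"
    and len: "length (nf (coord x \<otimes>\<^bsub>Z2D8\<^esub> h)) = Suc (length (nf h))"
  shows "x # nf h = nf (coord x \<otimes>\<^bsub>Z2D8\<^esub> h) \<or> (nf (coord x \<otimes>\<^bsub>Z2D8\<^esub> h), x # nf h) \<in> lenlex r"
proof -
  obtain m n d where h: "h = ((m, n), d)" and d: "d \<in> carrier (dihedral_group 4)"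
    using h by (rule Z2D8_cases)
  have len': "int (length (nf (coord x \<otimes>\<^bsub>Z2D8\<^esub> h))) = int (length (nf h)) + 1"
    using len by simp
  have lexI: "(y # w, x # nf h) \<in> lenlex r"
    if "nf (coord x \<otimes>\<^bsub>Z2D8\<^esub> h) = y # w" "(y, x) \<in> r" for y w
    using that len by (simp add: Cons_lenlex_iff)
  consider (eq) "x # nf h = nf (coord x \<otimes>\<^bsub>Z2D8\<^esub> h)"
    | (less) y w where "nf (coord x \<otimes>\<^bsub>Z2D8\<^esub> h) = y # w" "(y, x) \<in> r"
    using x
  proof (cases rule: K_Z_cases)
    case 1
    then have "0 \<le> m" using len' by (simp add: h coord_letter length_nf swaps_def D8_one[OF d])
    then show thesis
      using 1 by (intro eq) (simp add: h coord_letter swaps_def D8_one[OF d] nf_Cons)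
  next
    case 2
    then have "m \<le> 0" using len' by (simp add: h coord_letter length_nf swaps_def D8_one[OF d])
    then show thesis
      using 2 by (intro eq) (simp add: h coord_letter swaps_def D8_one[OF d] nf_Cons)
  next
    case 3
    then have n: "0 \<le> n" using len' by (simp add: h coord_letter length_nf swaps_def D8_one[OF d])
    have xh: "coord x \<otimes>\<^bsub>Z2D8\<^esub> h = ((m, n + 1), d)"
      using 3 by (simp add: h coord_letter swaps_def D8_one[OF d])
    show thesis
    proof (cases m "0 :: int" rule: linorder_cases)
      case m: less
      show thesis
        using 3 m letter_less(1) by (intro less[of "inv\<^bsub>K\<^esub> K_a" "nf ((m + 1, n + 1), d)"], unfold xh)
          (simp_all add: nf_Cons)
    next
      case m: equal
      show thesis using 3 m n by (intro eq) (simp add: h coord_letter swaps_def D8_one[OF d] nf_Cons)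
    next
      case m: greater
      show thesis
        using 3 m letter_less(1) by (intro less[of K_a "nf ((m - 1, n + 1), d)"], unfold xh)
          (simp_all add: nf_Cons)
    qed
  next
    case 4
    then have n: "n \<le> 0" using len' by (simp add: h coord_letter length_nf swaps_def D8_one[OF d])
    have xh: "coord x \<otimes>\<^bsub>Z2D8\<^esub> h = ((m, n - 1), d)"
      using 4 by (simp add: h coord_letter swaps_def D8_one[OF d])
    show thesis
    proof (cases m "0 :: int" rule: linorder_cases)
      case m: less
      show thesis
        using 4 m letter_less(1) by (intro less[of "inv\<^bsub>K\<^esub> K_a" "nf ((m + 1, n - 1), d)"], unfold xh)
          (simp_all add: nf_Cons)
    next
      case m: equal
      show thesis using 4 m n by (intro eq) (simp add: h coord_letter swaps_def D8_one[OF d] nf_Cons)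
    next
      case m: greater
      show thesis
        using 4 m letter_less(1) by (intro less[of K_a "nf ((m - 1, n - 1), d)"], unfold xh)
          (simp_all add: nf_Cons)
    qed
  next
    case 5
    have "coord x \<otimes>\<^bsub>Z2D8\<^esub> h = ((n, m), (0, True) \<otimes>\<^bsub>dihedral_group 4\<^esub> d)"
      using 5 by (simp add: h coord_letter swaps_def)
    note xh = this
    \<comment> \<open>Prepending \<open>t\<close> has exchanged the coordinates, so \<open>n\<close>
      is now the exponent of \<open>a\<close> and is examined first.\<close>
    show thesis
    proof (cases n "0 :: int" rule: linorder_cases)
      case n: equal
      show thesis
      proof (cases m "0 :: int" rule: linorder_cases)
        case equal
        then have "length (tu_word ((0, True) \<otimes>\<^bsub>dihedral_group 4\<^esub> d)) = Suc (length (tu_word d))"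
          using n len xh by (simp add: h nf_def power_word_0)
        then show thesis
          using 5 n equal tu_word_t[OF d] by (intro eq, unfold xh) (simp add: h nf_def power_word_0)
      next
        case m: less
        show thesis
          using 5 m n letter_less(4)
          by (intro less[of "inv\<^bsub>K\<^esub> K_b" "nf ((0, m + 1), (0, True) \<otimes>\<^bsub>dihedral_group 4\<^esub> d)"], unfold xh)
            (simp_all add: nf_Cons)
      next
        case m: greater
        show thesis
          using 5 m n letter_less(4)
          by (intro less[of K_b "nf ((0, m - 1), (0, True) \<otimes>\<^bsub>dihedral_group 4\<^esub> d)"], unfold xh)
            (simp_all add: nf_Cons)
      qed
    next
      case n: less
      show thesis
        using 5 n letter_less(2)
        by (intro less[of "inv\<^bsub>K\<^esub> K_a" "nf ((n + 1, m), (0, True) \<otimes>\<^bsub>dihedral_group 4\<^esub> d)"], unfold xh)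
          (simp_all add: nf_Cons)
    next
      case n: greater
      show thesis
        using 5 n letter_less(2)
        by (intro less[of K_a "nf ((n - 1, m), (0, True) \<otimes>\<^bsub>dihedral_group 4\<^esub> d)"], unfold xh)
          (simp_all add: nf_Cons)
    qed
  next
    case 6
    have "coord x \<otimes>\<^bsub>Z2D8\<^esub> h = ((m, n), (3, True) \<otimes>\<^bsub>dihedral_group 4\<^esub> d)"
      using 6 by (simp add: h coord_letter swaps_def)
    note xh = this
    show thesis
    proof (cases m "0 :: int" rule: linorder_cases)
      case m: equal
      show thesis
      proof (cases n "0 :: int" rule: linorder_cases)
        case equal
        then have len'': "length (tu_word ((3, True) \<otimes>\<^bsub>dihedral_group 4\<^esub> d)) = Suc (length (tu_word d))"
          using m len xh by (simp add: h nf_def power_word_0)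
        from tu_word_u[OF d len''] show thesis
        proof
          assume "tu_word ((3, True) \<otimes>\<^bsub>dihedral_group 4\<^esub> d) = K_u # tu_word d"
          then show thesis using 6 m equal by (intro eq, unfold xh) (simp add: h nf_def power_word_0)
        next
          assume "\<exists>w. tu_word ((3, True) \<otimes>\<^bsub>dihedral_group 4\<^esub> d) = K_t # w"
          then obtain w where "tu_word ((3, True) \<otimes>\<^bsub>dihedral_group 4\<^esub> d) = K_t # w" by blast
          then show thesis using 6 m equal tu by (intro less[of K_t w], unfold xh) (simp_all add: nf_def power_word_0)
        qed
      next
        case n: less
        show thesis
          using 6 m n letter_less(5)
          by (intro less[of "inv\<^bsub>K\<^esub> K_b" "nf ((0, n + 1), (3, True) \<otimes>\<^bsub>dihedral_group 4\<^esub> d)"], unfold xh)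
            (simp_all add: nf_Cons)
      next
        case n: greater
        show thesis
          using 6 m n letter_less(5)
          by (intro less[of K_b "nf ((0, n - 1), (3, True) \<otimes>\<^bsub>dihedral_group 4\<^esub> d)"], unfold xh)
            (simp_all add: nf_Cons)
      qed
    next
      case m: less
      show thesis
        using 6 m letter_less(3)
        by (intro less[of "inv\<^bsub>K\<^esub> K_a" "nf ((m + 1, n), (3, True) \<otimes>\<^bsub>dihedral_group 4\<^esub> d)"], unfold xh)
          (simp_all add: nf_Cons)
    next
      case m: greater
      show thesis
        using 6 m letter_less(3)
        by (intro less[of K_a "nf ((m - 1, n), (3, True) \<otimes>\<^bsub>dihedral_group 4\<^esub> d)"], unfold xh)
          (simp_all add: nf_Cons)
    qed
  qed
  then show ?thesis using lexI by cases auto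
qed

text \<open>Replacing the tail by its normal form does not increase the word, and neither does
  normalizing after the first letter.\<close>

lemma nf_least:
  "v \<in> lists K_Z \<Longrightarrow> v = nf (coord (word_val K v)) \<or> (nf (coord (word_val K v)), v) \<in> lenlex r"
proof (induction v)
  case Nil
  then show ?case by (simp add: coord_one nf_def power_word_def tu_word_def)
next
  case (Cons x v)
  let ?h = "coord (word_val K v)"
  have x: "x \<in> K_Z" and v: "v \<in> lists K_Z" using Cons.prems by auto
  have h: "?h \<in> carrier Z2D8" using v by (intro coord_carrier word_val_lists)
  note xv = coord_word_val_Cons[OF x v]
  have IH: "v = nf ?h \<or> (nf ?h, v) \<in> lenlex r" using Cons.IH v .
  show ?case
  proof (cases "length (nf (coord x \<otimes>\<^bsub>Z2D8\<^esub> ?h)) = Suc (length v)")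
    case False
    \<comment> \<open>Here the normal form is strictly shorter than the word, which decides the
      order.\<close>
    then show ?thesis
      using length_nf_coord_le[OF Cons.prems] unfolding xv by (simp add: lenlex_conv)
  next
    case True
    then have len: "length (nf ?h) = length v"
      using length_nf_le(1)[OF x h] length_nf_coord_le[OF v] by simp
    have "x # v = x # nf ?h \<or> (x # nf ?h, x # v) \<in> lenlex r"
      using IH by (auto simp: Cons_lenlex_iff)
    moreover have "x # nf ?h = nf (coord x \<otimes>\<^bsub>Z2D8\<^esub> ?h) \<or>
        (nf (coord x \<otimes>\<^bsub>Z2D8\<^esub> ?h), x # nf ?h) \<in> lenlex r"
      using True len by (intro lenlex_nf_Cons x h) simp
    ultimately show ?thesis unfolding xv using lenlex_trans[OF _ _ trans] by metis
  qed
qed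

section \<open>The shortlex languages\<close>

lemma shortlex_least_K:
  assumes "g \<in> carrier K"
  shows "shortlex_least K K_Z r {g} = nf (coord g)"
proof (rule shortlex_least_eqI[OF trans irrefl])
  show "v = nf (coord g) \<or> (nf (coord g), v) \<in> lenlex r"
    if "v \<in> lists K_Z" "word_val K v \<in> {g}" for v
    using nf_least[OF that(1)] that(2) by auto
qed (use assms nf_lists word_val_nf_coord in auto)

lemma SL_K: "SL K K_Z r = nf ` carrier Z2D8"
proof -
  have "SL K K_Z r = (\<lambda>g. nf (coord g)) ` carrier K"
    unfolding SL_def using shortlex_least_K by (auto simp: image_iff) metis+
  also have "\<dots> = nf ` coord ` carrier K" by (simp add: image_image)
  also have "coord ` carrier K = carrier Z2D8"
    using coord_iso by (simp add: iso_def bij_betw_def)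
  finally show ?thesis .
qed

lemma ConjMinLenSL_K: "ConjMinLenSL K K_Z r = SL K K_Z r \<inter> ConjGeo K K_Z"
proof -
  have "nf (coord g) \<in> ConjGeo K K_Z \<longleftrightarrow> elt_length K K_Z g = conj_length K K_Z g"
    if "g \<in> carrier K" for g
    using that nf_lists[of "coord g"]
    by (simp add: ConjGeo_def word_val_nf_coord elt_length_K del: in_lists_conv_set)
  then show ?thesis
    unfolding SL_def ConjMinLenSL_def using shortlex_least_K by auto
qed

text \<open>Equal coordinates are invariant under the swap, so the element is central and its class
  a singleton.\<close>

lemma diagonal_in_ConjSL: "replicate i K_a @ replicate i K_b \<in> ConjSL K K_Z r"
proof -
  define h :: "(int \<times> int) \<times> (int \<times> bool)" where "h = ((int i, int i), (0, False))"
  define g where "g = word_val K (nf h)"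
  have h: "h \<in> carrier Z2D8" by (simp add: h_def carrier_Z2D8 rots_def)
  have g: "g \<in> carrier K" "coord g = h"
    unfolding g_def using h by (simp_all add: word_val_lists nf_lists coord_nf)
  have central: "g \<otimes>\<^bsub>K\<^esub> k = k \<otimes>\<^bsub>K\<^esub> g" if k: "k \<in> carrier K" for k
  proof -
    obtain m n d where c: "coord k = ((m, n), d)" and d: "d \<in> carrier (dihedral_group 4)"
      using coord_carrier[OF k] by (rule Z2D8_cases)
    have "coord (g \<otimes>\<^bsub>K\<^esub> k) = coord (k \<otimes>\<^bsub>K\<^esub> g)"
      using g k by (simp add: coord_mult c h_def swaps_def D8_one[OF d] add.commute)
    then show ?thesis using inj_coord g k by (simp add: inj_on_eq_iff)
  qed
  have "inv\<^bsub>K\<^esub> k \<otimes>\<^bsub>K\<^esub> g \<otimes>\<^bsub>K\<^esub> k = g" if "k \<in> carrier K" for k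
    using g that by (simp add: K.m_assoc central) (simp flip: K.m_assoc)
  then have "conj_class K g = {g}" unfolding conj_class_def using K.one_closed by blast
  then have "replicate i K_a @ replicate i K_b = shortlex_least K K_Z r (conj_class K g)"
    using shortlex_least_K g by (simp add: h_def nf_replicate)
  then show ?thesis using g(1) unfolding ConjSL_def by blast
qed

text \<open>Conjugation by \<open>t\<close> exchanges the exponents, and the resulting word
  \<open>?v\<close> is smaller than \<open>?w\<close>.\<close>

lemma ConjSL_diagonal_bound:
  assumes "i < j"
  shows "replicate i K_a @ replicate j K_b \<notin> ConjSL K K_Z r"
proof
  let ?w = "replicate i K_a @ replicate j K_b" and ?v = "replicate j K_a @ replicate i K_b"
  assume "?w \<in> ConjSL K K_Z r"
  then obtain g where g: "g \<in> carrier K" and w: "?w = shortlex_least K K_Z r (conj_class K g)"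
    by (auto simp: ConjSL_def)
  have "g \<in> conj_class K g"
    unfolding conj_class_def using g by (auto intro!: exI[of _ "\<one>\<^bsub>K\<^esub>"])
  moreover have "finite K_Z" by (simp add: K_Z_def)
  ultimately have least: "word_val K ?w \<in> conj_class K g"
    "\<And>v. v \<in> lists K_Z \<Longrightarrow> word_val K v \<in> conj_class K g \<Longrightarrow> v = ?w \<or> (?w, v) \<in> lenlex r"
    using shortlex_least_works[OF _ order, of "nf (coord g)" K "conj_class K g"]
      nf_lists word_val_nf_coord[OF g] unfolding w by auto
  obtain k where k: "k \<in> carrier K" "word_val K ?w = inv\<^bsub>K\<^esub> k \<otimes>\<^bsub>K\<^esub> g \<otimes>\<^bsub>K\<^esub> k"
    using least(1) by (auto simp: conj_class_def)
  have wv: "?w \<in> lists K_Z" "?v \<in> lists K_Z" by (auto simp: K_Z_def)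
  have c: "coord (word_val K ?w) = ((int i, int j), (0, False))"
    "coord (word_val K ?v) = ((int j, int i), (0, False))"
    unfolding nf_replicate[symmetric] by (auto intro!: coord_nf simp: carrier_Z2D8 rots_def)
  have "coord (word_val K ?w \<otimes>\<^bsub>K\<^esub> K_t) = coord (K_t \<otimes>\<^bsub>K\<^esub> word_val K ?v)"
    using wv[THEN word_val_lists] by (simp add: coord_mult c coord_letter swaps_def mult_D8)
  then have eq: "word_val K ?w \<otimes>\<^bsub>K\<^esub> K_t = K_t \<otimes>\<^bsub>K\<^esub> word_val K ?v"
    using inj_coord wv[THEN word_val_lists] by (simp add: inj_on_eq_iff)
  have "word_val K ?v = inv\<^bsub>K\<^esub> K_t \<otimes>\<^bsub>K\<^esub> (word_val K ?w \<otimes>\<^bsub>K\<^esub> K_t)"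
    unfolding eq using wv[THEN word_val_lists] by (simp flip: K.m_assoc)
  also have "\<dots> = inv\<^bsub>K\<^esub> (k \<otimes>\<^bsub>K\<^esub> K_t) \<otimes>\<^bsub>K\<^esub> g \<otimes>\<^bsub>K\<^esub> (k \<otimes>\<^bsub>K\<^esub> K_t)"
    unfolding k(2) using g k(1) by (simp add: K.m_assoc K.inv_mult_group)
  finally have "word_val K ?v \<in> conj_class K g" unfolding conj_class_def using k(1) by auto
  then have "?v = ?w \<or> (?w, ?v) \<in> lenlex r" using least(2) wv by blast
  moreover have "(?v, ?w) \<in> lenlex r"
  proof -
    \<comment> \<open>After the common prefix of \<open>i\<close> letters \<open>a\<close>, the next
      letters are \<open>a\<close> in \<open>?v\<close> and \<open>b\<close> in
      \<open>?w\<close>.\<close>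
    obtain l where j: "j = Suc (i + l)" using assms less_imp_Suc_add by blast
    then have v: "?v = replicate i K_a @ K_a # (replicate l K_a @ replicate i K_b)"
      and w: "?w = replicate i K_a @ K_b # (replicate (i + l) K_b)"
      by (simp_all add: replicate_add replicate_app_Cons_same)
    show ?thesis
      unfolding v w using letter_less(1)[of K_a K_b] irrefl
      by (subst lenlex_append2) (auto simp: Cons_lenlex_iff)
  qed
  ultimately have "(?v, ?v) \<in> lenlex r" using lenlex_trans[OF _ _ trans] by metis
  then show False using lenlex_irreflexive irrefl unfolding irrefl_def by blast
qed

text \<open>The quotients by powers of \<open>a\<close> are pairwise distinct: for
  \<open>i < j\<close>, the word of \<open>j\<close> letters \<open>b\<close> may follow
  \<open>j\<close> letters \<open>a\<close> but not \<open>i\<close>.\<close>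

lemma ConjSL_not_regular: "\<not> regular_language K_Z (ConjSL K K_Z r)"
proof
  assume "regular_language K_Z (ConjSL K K_Z r)"
  then have fin: "finite (left_quotients K_Z (ConjSL K K_Z r))"
    by (simp add: regular_language_iff_finite_quotients)
  let ?q = "\<lambda>i. left_quotient K_Z (ConjSL K K_Z r) (replicate i K_a)"
  have Z: "K_a \<in> K_Z" "K_b \<in> K_Z" by (auto simp: K_Z_def)
  have "range ?q \<subseteq> left_quotients K_Z (ConjSL K K_Z r)"
    using Z by (intro image_subsetI imageI) auto
  then have "\<not> inj ?q" using finite_subset[OF _ fin] finite_imageD by blast
  then obtain i j where "?q i = ?q j" "i < j" unfolding inj_def by (metis linorder_neqE_nat)
  moreover have "replicate j K_b \<in> ?q j"
    using diagonal_in_ConjSL Z by (auto simp: left_quotient_def in_lists_conv_set)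
  ultimately have "replicate j K_b \<in> ?q i" by simp
  then show False using ConjSL_diagonal_bound[OF \<open>i < j\<close>] by (simp add: left_quotient_def)
qed

end

theorem proposition5p3:
  fixes r :: "K_elt rel"
  assumes "strict_linear_order_on K_Z r"
    and "{K_a, inv\<^bsub>K\<^esub> K_a} \<times> {K_b, inv\<^bsub>K\<^esub> K_b} \<subseteq> r"
    and "{K_b, inv\<^bsub>K\<^esub> K_b} \<times> {K_t} \<subseteq> r"
    and "(K_t, K_u) \<in> r"
  shows "K \<cong> semidirect_product Z2 (dihedral_group 4) D8_act \<and>
    regular_language K_Z (Geo K K_Z) \<and>
    regular_language K_Z (SL K K_Z r) \<and>
    regular_language K_Z (ConjGeo K K_Z) \<and>
    regular_language K_Z (ConjMinLenSL K K_Z r) \<and>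
    \<not> regular_language K_Z (ConjSL K K_Z r)"
proof -
  interpret K_order r using assms by unfold_locales
  have SL: "regular_language K_Z (SL K K_Z r)" using regular_nf by (simp add: SL_K)
  then show ?thesis
    using coord_iso[THEN is_isoI] regular_Geo regular_ConjGeo ConjSL_not_regular
      regular_language_Int[OF SL regular_ConjGeo] by (simp add: ConjMinLenSL_K)
qed

end
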